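(* There exist absolute constants $\bar\ell_1,\bar\ell_2>0$ such that the following holds. For any $\Delta,\ell,L_2,\mu,\epsilon>0$ with $\kappa_y=\ell/\mu\ge1$ and $$\epsilon\le\min\Big\{\frac14\Big(\frac{\ell}{\bar\ell_1}\Big)^{2}\Big(\frac{L_2}{\bar\ell_2}\Big)^{-1},\ \frac14\Delta^{7/10}\Big(\frac{\ell}{\bar\ell_1}\Big)^{-1/10}\Big(\frac{L_2}{\bar\ell_2}\Big)^{2/5}\Big\},$$ there exists a saddle point problem $\min_x\max_y f(x,y)$ such that: (i) $f$ is $\ell$-smooth and $\mu$-strongly concave in $y$; (ii) $\Phi(x):=\max_y f(x,y)$ has $L_2$-Lipschitz Hessian and $\Phi(0)-\min_x\Phi(x)\le\Delta$. Moreover, to find some $\bar x$ with $\|\nabla\Phi(\bar x)\|\le\epsilon$ for this problem, any first-order algorithm needs at least $\Omega\big(\Delta\sqrt{\kappa_y}\,\ell^{3/7}L_2^{2/7}\epsilon^{-12/7}\big)$ gradient evaluations.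
   Context: A first-order oracle, queried at $(x,y)$, returns $(f(x,y),\nabla_x f(x,y),\nabla_y f(x,y))$. A first-order algorithm starts from $(x_0,y_0)=(0,0)$ and its iterates satisfy $\operatorname{supp}(x_{t+1},y_{t+1})\subset\bigcup_{0\le i\le t}\big(\operatorname{supp}(x_i,y_i)\cup\operatorname{supp}(\nabla_x f(x_i,y_i),\nabla_y f(x_i,y_i))\big)$, where $\operatorname{supp}$ denotes the set of indices of nonzero coordinates. *)

theory Defs
  imports Complex_Main
begin

text \<open>Euclidean space R^d is represented by functions nat => real vanishing outside {..<d};
  the dimension d is an explicit number so that it can be existentially chosen.\<close>

definition vec :: "nat \<Rightarrow> (nat \<Rightarrow> real) set" where
  "vec d = {v. \<forall>i\<ge>d. v i = 0}"

definition ip :: "nat \<Rightarrow> (nat \<Rightarrow> real) \<Rightarrow> (nat \<Rightarrow> real) \<Rightarrow> real" where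
  "ip d u v = (\<Sum>i<d. u i * v i)"

definition enorm :: "nat \<Rightarrow> (nat \<Rightarrow> real) \<Rightarrow> real" where
  "enorm d v = sqrt (ip d v v)"

definition vadd :: "(nat \<Rightarrow> real) \<Rightarrow> (nat \<Rightarrow> real) \<Rightarrow> (nat \<Rightarrow> real)" where
  "vadd u v = (\<lambda>i. u i + v i)"

definition vsub :: "(nat \<Rightarrow> real) \<Rightarrow> (nat \<Rightarrow> real) \<Rightarrow> (nat \<Rightarrow> real)" where
  "vsub u v = (\<lambda>i. u i - v i)"

definition supp :: "(nat \<Rightarrow> real) \<Rightarrow> nat set" where
  "supp v = {i. v i \<noteq> 0}"

definition has_grad :: "nat \<Rightarrow> ((nat \<Rightarrow> real) \<Rightarrow> real) \<Rightarrow> (nat \<Rightarrow> real) \<Rightarrow> (nat \<Rightarrow> real) \<Rightarrow> bool" where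
  "has_grad d g G x \<longleftrightarrow> G \<in> vec d \<and>
     (\<forall>e>0. \<exists>\<delta>>0. \<forall>h\<in>vec d. enorm d h < \<delta> \<longrightarrow>
        \<bar>g (vadd x h) - g x - ip d G h\<bar> \<le> e * enorm d h)"

definition has_grad2 :: "nat \<Rightarrow> nat \<Rightarrow> ((nat \<Rightarrow> real) \<Rightarrow> (nat \<Rightarrow> real) \<Rightarrow> real)
    \<Rightarrow> (nat \<Rightarrow> real) \<Rightarrow> (nat \<Rightarrow> real) \<Rightarrow> (nat \<Rightarrow> real) \<Rightarrow> (nat \<Rightarrow> real) \<Rightarrow> bool" where
  "has_grad2 dx dy f Gx Gy x y \<longleftrightarrow> Gx \<in> vec dx \<and> Gy \<in> vec dy \<and>
     (\<forall>e>0. \<exists>\<delta>>0. \<forall>h\<in>vec dx. \<forall>k\<in>vec dy.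
        sqrt ((enorm dx h)\<^sup>2 + (enorm dy k)\<^sup>2) < \<delta> \<longrightarrow>
        \<bar>f (vadd x h) (vadd y k) - f x y - ip dx Gx h - ip dy Gy k\<bar>
          \<le> e * sqrt ((enorm dx h)\<^sup>2 + (enorm dy k)\<^sup>2))"

definition smooth_with_grad :: "nat \<Rightarrow> nat \<Rightarrow> ((nat \<Rightarrow> real) \<Rightarrow> (nat \<Rightarrow> real) \<Rightarrow> real)
    \<Rightarrow> ((nat \<Rightarrow> real) \<Rightarrow> (nat \<Rightarrow> real) \<Rightarrow> (nat \<Rightarrow> real))
    \<Rightarrow> ((nat \<Rightarrow> real) \<Rightarrow> (nat \<Rightarrow> real) \<Rightarrow> (nat \<Rightarrow> real)) \<Rightarrow> real \<Rightarrow> bool" where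
  "smooth_with_grad dx dy f gx gy l \<longleftrightarrow>
     (\<forall>x\<in>vec dx. \<forall>y\<in>vec dy. has_grad2 dx dy f (gx x y) (gy x y) x y) \<and>
     (\<forall>x\<in>vec dx. \<forall>y\<in>vec dy. \<forall>x'\<in>vec dx. \<forall>y'\<in>vec dy.
        sqrt ((enorm dx (vsub (gx x y) (gx x' y')))\<^sup>2 + (enorm dy (vsub (gy x y) (gy x' y')))\<^sup>2)
          \<le> l * sqrt ((enorm dx (vsub x x'))\<^sup>2 + (enorm dy (vsub y y'))\<^sup>2))"

definition concave_vec :: "nat \<Rightarrow> ((nat \<Rightarrow> real) \<Rightarrow> real) \<Rightarrow> bool" where
  "concave_vec d g \<longleftrightarrow> (\<forall>a\<in>vec d. \<forall>b\<in>vec d. \<forall>t::real. 0 \<le> t \<and> t \<le> 1 \<longrightarrow>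
      t * g a + (1 - t) * g b \<le> g (\<lambda>i. t * a i + (1 - t) * b i))"

definition strongly_concave_y :: "nat \<Rightarrow> nat \<Rightarrow> ((nat \<Rightarrow> real) \<Rightarrow> (nat \<Rightarrow> real) \<Rightarrow> real) \<Rightarrow> real \<Rightarrow> bool" where
  "strongly_concave_y dx dy f \<mu> \<longleftrightarrow>
     (\<forall>x\<in>vec dx. concave_vec dy (\<lambda>y. f x y + \<mu> / 2 * (enorm dy y)\<^sup>2))"

definition Phi :: "nat \<Rightarrow> ((nat \<Rightarrow> real) \<Rightarrow> (nat \<Rightarrow> real) \<Rightarrow> real) \<Rightarrow> (nat \<Rightarrow> real) \<Rightarrow> real" where
  "Phi dy f x = (SUP y\<in>vec dy. f x y)"

definition hessian_lipschitz :: "nat \<Rightarrow> ((nat \<Rightarrow> real) \<Rightarrow> real) \<Rightarrow> real \<Rightarrow> bool" where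
  "hessian_lipschitz d g L \<longleftrightarrow> (\<exists>G H.
     (\<forall>x\<in>vec d. has_grad d g (G x) x \<and> (\<forall>i<d. has_grad d (\<lambda>z. G z i) (H x i) x)) \<and>
     (\<forall>x\<in>vec d. \<forall>x'\<in>vec d. \<forall>v\<in>vec d.
        enorm d (\<lambda>i. ip d (H x i) v - ip d (H x' i) v) \<le> L * enorm d (vsub x x') * enorm d v))"

definition first_order_iterates :: "((nat \<Rightarrow> real) \<Rightarrow> (nat \<Rightarrow> real) \<Rightarrow> (nat \<Rightarrow> real))
    \<Rightarrow> ((nat \<Rightarrow> real) \<Rightarrow> (nat \<Rightarrow> real) \<Rightarrow> (nat \<Rightarrow> real))
    \<Rightarrow> (nat \<Rightarrow> nat \<Rightarrow> real) \<Rightarrow> (nat \<Rightarrow> nat \<Rightarrow> real) \<Rightarrow> bool" where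
  "first_order_iterates gx gy xs ys \<longleftrightarrow> xs 0 = (\<lambda>_. 0) \<and> ys 0 = (\<lambda>_. 0) \<and>
     (\<forall>t. supp (xs (Suc t)) \<subseteq> (\<Union>i\<le>t. supp (xs i) \<union> supp (gx (xs i) (ys i))) \<and>
          supp (ys (Suc t)) \<subseteq> (\<Union>i\<le>t. supp (ys i) \<union> supp (gy (xs i) (ys i))))"

end

(* Take Carmon et al.'s chain F(x) = b/2 (x_0 - 1)^2 + 1/2 sum (x_i - x_(i+1))^2 + b^2 sum pot(x_i). If its last two
   coordinates vanish, the chain has to pass from 1 to 0, which costs a gradient of norm about b^(3/2). Every coupling
   1/2 (x_i - x_(i+1))^2 is written as a maximum over m dual variables forming a path with mass 1/(m(m+1)) from x_i to
   x_(i+1); strong concavity with modulus mu permits m of order sqrt(l/mu). Interlacing x and y along these paths turns f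
   into a single nearest-neighbour chain, so every gradient call reveals at most one new coordinate, and the last x
   coordinates stay zero for about T (m+1) calls. Rescaling x, y and the values fits l, L2, Delta and epsilon. *)
theory Submission
  imports Defs
begin

section \<open>A decreasing potential with a critical point at 0\<close>

text \<open>The condition number has to multiply the length of the chain without changing
  \<open>Phi\<close>. The Green function of a path with mass is explicit, so eliminating the duals
  gives back (s - t)^2 / 2 exactly; gap, Hessian and gradient of \<open>Phi\<close> are those of the
  plain chain for every m, and m only sets the number of queries per edge. The power b^(3/2) arises
  since 1 - x grows at least like a solution of z'' = b^2 z: it gains speed of order b, and stopping
  it within 1/b nodes takes residuals of order b^2. The exponents come from balancing scales. Up to
  constants, the Hessian has Lipschitz constant lam b^2 / sig, the gradient bound is lam sig
  b^(3/2), and each node costs lam sig^2 b^2 of the gap. Equating the first two with L2 and epsilon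
  gives b^(7/2) ~ epsilon L2 / lam^2, and Delta / (lam sig^2 b^2) nodes become Delta lam^(3/7)
  L2^(2/7) epsilon^(-12/7). The first bound on epsilon keeps b <= 1/2, the second keeps the boundary
  cost lam sig^2 b below a fraction of Delta.\<close>

lemma lipschitz_of_bounded_deriv:
  fixes f f' :: "real \<Rightarrow> real"
  assumes "\<And>x. (f has_real_derivative f' x) (at x)" "\<And>x. \<bar>f' x\<bar> \<le> K"
  shows "\<bar>f x - f y\<bar> \<le> K * \<bar>x - y\<bar>"
proof -
  have *: "\<bar>f x - f y\<bar> \<le> K * \<bar>x - y\<bar>" if "y < x" for x y
  proof -
    have "\<exists>c>y. c < x \<and> f x - f y = (x - y) * f' c"
      by (rule MVT2[OF that assms(1)])
    then obtain c where "f x - f y = (x - y) * f' c" by blast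
    then show ?thesis
      using assms(2)[of c] by (simp add: abs_mult mult.commute mult_right_mono)
  qed
  show ?thesis
    using *[of x y] *[of y x] by (cases x y rule: linorder_cases) (auto simp: abs_minus_commute)
qed

text \<open>The mean value theorem yields K h^2 without integration; the lost factor 1/2 only
  affects absolute constants.\<close>

lemma taylor_of_lipschitz_deriv:
  fixes f f' :: "real \<Rightarrow> real"
  assumes "\<And>x. (f has_real_derivative f' x) (at x)" "\<And>x y. \<bar>f' x - f' y\<bar> \<le> K * \<bar>x - y\<bar>"
  shows "\<bar>f (x + h) - f x - f' x * h\<bar> \<le> K * h\<^sup>2"
proof -
  have K: "0 \<le> K" using assms(2)[of 0 1] by simp
  obtain c where c: "f (x + h) - f x = h * f' c" "\<bar>c - x\<bar> \<le> \<bar>h\<bar>"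
  proof (cases h "0::real" rule: linorder_cases)
    case less
    then obtain c where "x + h < c" "c < x" "f x - f (x + h) = (x - (x + h)) * f' c"
      using MVT2[of "x + h" x f f'] assms(1) by auto
    then show ?thesis using less by (intro that[of c]) (auto simp: algebra_simps)
  next
    case equal then show ?thesis by (intro that[of x]) auto
  next
    case greater
    then obtain c where "x < c" "c < x + h" "f (x + h) - f x = (x + h - x) * f' c"
      using MVT2[of x "x + h" f f'] assms(1) by auto
    then show ?thesis using greater by (intro that[of c]) (auto simp: algebra_simps)
  qed
  have "\<bar>f (x + h) - f x - f' x * h\<bar> = \<bar>h\<bar> * \<bar>f' c - f' x\<bar>"
    unfolding c(1) by (simp add: algebra_simps flip: abs_mult)
  also have "\<dots> \<le> \<bar>h\<bar> * (K * \<bar>c - x\<bar>)" by (intro mult_left_mono assms(2)) auto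
  also have "\<dots> \<le> \<bar>h\<bar> * (K * \<bar>h\<bar>)" using c(2) K by (intro mult_left_mono) auto
  finally show ?thesis by (simp add: power2_eq_square algebra_simps flip: abs_mult)
qed

lemma lipschitz_mult:
  fixes f g :: "real \<Rightarrow> real"
  assumes "\<bar>f x - f y\<bar> \<le> A * \<bar>x - y\<bar>" "\<bar>g x - g y\<bar> \<le> B * \<bar>x - y\<bar>" "\<bar>f x\<bar> \<le> 1" "\<bar>g y\<bar> \<le> 1"
  shows "\<bar>f x * g x - f y * g y\<bar> \<le> (A + B) * \<bar>x - y\<bar>"
proof -
  have "f x * g x - f y * g y = f x * (g x - g y) + (f x - f y) * g y" by (simp add: algebra_simps)
  then have "\<bar>f x * g x - f y * g y\<bar> \<le> \<bar>f x\<bar> * \<bar>g x - g y\<bar> + \<bar>f x - f y\<bar> * \<bar>g y\<bar>"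
    by (simp add: abs_triangle_ineq flip: abs_mult)
  also have "\<dots> \<le> 1 * (B * \<bar>x - y\<bar>) + (A * \<bar>x - y\<bar>) * 1"
    using assms by (intro add_mono mult_mono) auto
  finally show ?thesis by (simp add: algebra_simps)
qed

text \<open>The potential composes the softplus function with \<open>arctan x - x\<close>, whose derivative vanishes to second
  order at 0 and is bounded. So \<open>pot'\<close> vanishes at 0, which the zero chain needs, while \<open>pot\<close> stays
  decreasing, bounded below, and steep both near \<open>x = 1/2\<close> and for \<open>x \<le> -1/4\<close>.\<close>

definition squash :: "real \<Rightarrow> real" where "squash x = x\<^sup>2 / (1 + x\<^sup>2)"
definition squash' :: "real \<Rightarrow> real" where "squash' x = 2 * x / (1 + x\<^sup>2)\<^sup>2"
definition logi :: "real \<Rightarrow> real" where "logi x = 1 / (1 + exp (x - arctan x))"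
definition pot :: "real \<Rightarrow> real" where "pot x = 20 * ln (1 + exp (arctan x - x))"
definition pot' :: "real \<Rightarrow> real" where "pot' x = - 20 * (logi x * squash x)"
definition pot'' :: "real \<Rightarrow> real" where
  "pot'' x = - 20 * (logi x * squash' x - logi x * (1 - logi x) * (squash x * squash x))"

lemma squash_bounds: "0 \<le> squash x" "squash x \<le> 1"
  by (auto simp: squash_def divide_simps add_pos_nonneg)

lemma logi_bounds: "0 < logi x" "logi x < 1"
  by (auto simp: logi_def divide_simps add_pos_pos)

lemma squash'_bound: "\<bar>squash' x\<bar> \<le> 1"
proof -
  have "0 \<le> (\<bar>x\<bar> - 1)\<^sup>2" by simp
  then have "\<bar>2 * x\<bar> \<le> 1 + x\<^sup>2" by (simp add: power2_diff)
  also have "\<dots> \<le> (1 + x\<^sup>2)\<^sup>2" by (intro self_le_power) auto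
  finally show ?thesis unfolding squash'_def by (simp add: abs_mult divide_le_eq)
qed

lemma arctan_diff_deriv: "((\<lambda>x. x - arctan x) has_real_derivative squash x) (at x)"
proof -
  have "1 + x\<^sup>2 \<noteq> 0" by (metis add_pos_nonneg zero_le_power2 less_irrefl zero_less_one)
  then have "1 - inverse (1 + x\<^sup>2) = squash x" by (simp add: squash_def field_simps)
  then show ?thesis by (auto intro!: derivative_eq_intros)
qed

lemma logi_deriv: "(logi has_real_derivative - (logi x * (1 - logi x) * squash x)) (at x)"
proof -
  have *: "1 + exp (x - arctan x) \<noteq> 0" by (metis add_pos_pos exp_gt_zero less_irrefl zero_less_one)
  have "((\<lambda>x. 1 / (1 + exp (x - arctan x))) has_real_derivative
      - (exp (x - arctan x) * squash x) / (1 + exp (x - arctan x))\<^sup>2) (at x)"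
    by (rule derivative_eq_intros arctan_diff_deriv refl * | simp add: power2_eq_square)+
  moreover have "- (exp (x - arctan x) * squash x) / (1 + exp (x - arctan x))\<^sup>2
      = - (logi x * (1 - logi x) * squash x)"
    using * by (simp add: logi_def field_simps power2_eq_square)
  ultimately show ?thesis by (simp add: logi_def[abs_def])
qed

lemma squash_deriv: "(squash has_real_derivative squash' x) (at x)"
proof -
  have *: "1 + x\<^sup>2 \<noteq> 0" by (metis add_pos_nonneg zero_le_power2 less_irrefl zero_less_one)
  show ?thesis unfolding squash_def[abs_def] squash'_def
    using * by (auto intro!: derivative_eq_intros simp: divide_simps) (simp add: algebra_simps power2_eq_square)
qed

lemma squash'_deriv: "(squash' has_real_derivative (2 - 6 * x\<^sup>2) / (1 + x\<^sup>2) ^ 3) (at x)"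
proof -
  have *: "1 + x\<^sup>2 \<noteq> 0" by (metis add_pos_nonneg zero_le_power2 less_irrefl zero_less_one)
  show ?thesis unfolding squash'_def[abs_def]
    using * by (auto intro!: derivative_eq_intros simp: divide_simps) algebra
qed

lemma pot_deriv: "(pot has_real_derivative pot' x) (at x)"
proof -
  have *: "1 + exp (arctan x - x) > 0" by (simp add: add_pos_pos)
  have d: "((\<lambda>x. arctan x - x) has_real_derivative - squash x) (at x)"
    using DERIV_minus[OF arctan_diff_deriv, of x] by simp
  have "(pot has_real_derivative 20 * (exp (arctan x - x) * - squash x / (1 + exp (arctan x - x)))) (at x)"
    unfolding pot_def[abs_def]
    by (rule derivative_eq_intros d refl * | simp)+
  moreover have "exp (arctan x - x) / (1 + exp (arctan x - x)) = logi x"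
    unfolding logi_def using * add_pos_pos[OF zero_less_one exp_gt_zero[of "x - arctan x"]]
    by (simp add: divide_simps exp_diff algebra_simps)
  ultimately show ?thesis by (simp add: pot'_def) (metis (no_types, lifting) mult.commute times_divide_eq_left)
qed

lemma pot'_deriv: "(pot' has_real_derivative pot'' x) (at x)"
  unfolding pot'_def[abs_def] pot''_def
  by (rule derivative_eq_intros logi_deriv squash_deriv refl)+ (simp add: algebra_simps)

lemma lipschitz_logi: "\<bar>logi x - logi y\<bar> \<le> 1 * \<bar>x - y\<bar>"
proof (rule lipschitz_of_bounded_deriv[OF logi_deriv])
  fix x show "\<bar>- (logi x * (1 - logi x) * squash x)\<bar> \<le> 1"
    using logi_bounds[of x] squash_bounds[of x] by (simp add: abs_mult mult_le_one)
qed

lemma lipschitz_squash: "\<bar>squash x - squash y\<bar> \<le> 1 * \<bar>x - y\<bar>"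
  by (rule lipschitz_of_bounded_deriv[OF squash_deriv squash'_bound])

lemma lipschitz_squash': "\<bar>squash' x - squash' y\<bar> \<le> 6 * \<bar>x - y\<bar>"
proof (rule lipschitz_of_bounded_deriv[OF squash'_deriv])
  fix x :: real
  have "\<bar>2 - 6 * x\<^sup>2\<bar> \<le> 6 * (1 + x\<^sup>2)" using zero_le_power2[of x] by (simp only: abs_le_iff) simp
  also have "\<dots> \<le> 6 * (1 + x\<^sup>2) ^ 3" using self_le_power[of "1 + x\<^sup>2" 3] by simp
  finally show "\<bar>(2 - 6 * x\<^sup>2) / (1 + x\<^sup>2) ^ 3\<bar> \<le> 6"
    by (simp add: abs_divide divide_le_eq add_pos_nonneg)
qed

lemma pot''_bound: "\<bar>pot'' x\<bar> \<le> 40"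
proof -
  have "\<bar>logi x * squash' x\<bar> \<le> 1"
    using logi_bounds[of x] squash'_bound[of x] by (simp add: abs_mult mult_le_one)
  moreover have "\<bar>logi x * (1 - logi x) * (squash x * squash x)\<bar> \<le> 1"
    using logi_bounds[of x] squash_bounds[of x] by (simp add: abs_mult mult_le_one)
  moreover have "\<bar>- 20 * (u - v)\<bar> \<le> 40" if "\<bar>u\<bar> \<le> 1" "\<bar>v\<bar> \<le> 1" for u v :: real
    using that by (auto simp: abs_le_iff)
  ultimately show ?thesis unfolding pot''_def by blast
qed

lemma lipschitz_pot': "\<bar>pot' x - pot' y\<bar> \<le> 40 * \<bar>x - y\<bar>"
  by (rule lipschitz_of_bounded_deriv[OF pot'_deriv pot''_bound])

text \<open>Here 220 = 20 * (7 + 4): the product with \<open>squash'\<close> contributes 1 + 6, and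
  the product of four 1-Lipschitz factors bounded by 1 contributes 4.\<close>

lemma lipschitz_pot'': "\<bar>pot'' x - pot'' y\<bar> \<le> 220 * \<bar>x - y\<bar>"
proof -
  have l: "\<bar>logi z\<bar> \<le> 1" "\<bar>1 - logi z\<bar> \<le> 1" "\<bar>squash z\<bar> \<le> 1" for z
    using logi_bounds[of z] squash_bounds[of z] by auto
  have a: "\<bar>logi x * squash' x - logi y * squash' y\<bar> \<le> (1 + 6) * \<bar>x - y\<bar>"
    by (intro lipschitz_mult lipschitz_logi lipschitz_squash' l squash'_bound)
  have "\<bar>(1 - logi x) - (1 - logi y)\<bar> \<le> 1 * \<bar>x - y\<bar>"
    using lipschitz_logi[of x y] by linarith
  then have "\<bar>logi x * (1 - logi x) - logi y * (1 - logi y)\<bar> \<le> (1 + 1) * \<bar>x - y\<bar>"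
    by (intro lipschitz_mult[where f = logi and g = "\<lambda>z. 1 - logi z"] lipschitz_logi l)
  moreover have "\<bar>squash x * squash x - squash y * squash y\<bar> \<le> (1 + 1) * \<bar>x - y\<bar>"
    by (intro lipschitz_mult lipschitz_squash l)
  ultimately have b: "\<bar>logi x * (1 - logi x) * (squash x * squash x)
      - logi y * (1 - logi y) * (squash y * squash y)\<bar> \<le> (1 + 1 + (1 + 1)) * \<bar>x - y\<bar>"
    by (intro lipschitz_mult[where f = "\<lambda>z. logi z * (1 - logi z)" and g = "\<lambda>z. squash z * squash z"])
       (auto simp only: abs_mult abs_ge_zero intro!: mult_le_one l)
  have "\<bar>- 20 * (u - v) - - 20 * (u' - v')\<bar> \<le> 220 * d"
    if "\<bar>u - u'\<bar> \<le> (1 + 6) * d" "\<bar>v - v'\<bar> \<le> (1 + 1 + (1 + 1)) * d" for u v u' v' d :: real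
    using that by (auto simp: abs_le_iff)
  then show ?thesis unfolding pot''_def using a b by blast
qed

lemma pot_nonneg: "0 \<le> pot x"
  by (simp add: pot_def)

lemma pot_0_le: "pot 0 \<le> 20"
  using ln_le_minus_one[of 2] by (simp add: pot_def)

lemma pot'_0 [simp]: "pot' 0 = 0"
  by (simp add: pot'_def squash_def)

lemma pot'_nonpos: "pot' x \<le> 0"
  using logi_bounds[of x] squash_bounds[of x] by (simp add: pot'_def)

text \<open>This sizes the factor 20 in \<open>pot\<close>: on [1/2, 1] the factors
  \<open>logi\<close> and \<open>squash\<close> are at least 1/4 and 1/5, so the slope is at most
  -1, hence at most -2 (1 - x). Beyond 1 the sign of \<open>pot'\<close> is enough.\<close>

lemma pot'_right:
  assumes "1/2 \<le> x" shows "pot' x \<le> - 2 * (1 - x)"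
proof (cases "x \<le> 1")
  case True
  have "exp (x - arctan x) \<le> exp 1" using True assms zero_le_arctan_iff[of x] by (simp del: zero_le_arctan_iff)
  then have "exp (x - arctan x) \<le> 3" using exp_le by linarith
  then have "1/4 \<le> logi x" by (simp add: logi_def divide_simps add_pos_pos)
  moreover have "(1/2)\<^sup>2 \<le> x\<^sup>2" using assms by (intro power_mono) auto
  then have "1/5 \<le> squash x" by (simp add: squash_def divide_simps add_pos_nonneg power2_eq_square)
  ultimately have "1/4 * (1/5) \<le> logi x * squash x" by (intro mult_mono) auto
  then show ?thesis using assms by (simp add: pot'_def)
next
  case False then show ?thesis using pot'_nonpos[of x] by auto
qed

lemma pot'_left:
  assumes "x \<le> -1/4" shows "pot' x \<le> - 1/2"
proof -
  have "0 - arctan 0 \<ge> x - arctan x"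
    using DERIV_nonneg_imp_nondecreasing[of x 0 "\<lambda>x. x - arctan x"] arctan_diff_deriv squash_bounds(1) assms
    by (metis (no_types) order.trans[of x "-1/4" 0] divide_nonpos_pos neg_le_0_iff_le zero_le_one zero_less_numeral)
  then have "x \<le> arctan x" by simp
  then have "1/2 \<le> logi x" by (simp add: logi_def divide_simps add_pos_pos)
  moreover have "(1/4)\<^sup>2 \<le> (-x)\<^sup>2" using assms by (intro power_mono) auto
  then have "1/17 \<le> squash x" by (simp add: squash_def divide_simps add_pos_nonneg power2_eq_square)
  ultimately have "1/2 * (1/17) \<le> logi x * squash x" by (intro mult_mono) auto
  then show ?thesis by (simp add: pot'_def)
qed

section \<open>Lower bound on the gradient\<close>

text \<open>Discrete shooting argument for \<open>z'' = b\<^sup>2 \<psi>(z) - r\<close> with speed \<open>s\<close>. As long as \<open>z \<le> 1/2\<close>, the quantity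
  \<open>s - b z\<close> contracts at rate \<open>1 - b\<close> up to the perturbation \<open>r\<close>, so \<open>z\<close> passes 1/2 with speed at least \<open>b/4\<close>.
  Afterwards the loss of speed is paid for by the progress of \<open>z\<close> on \<open>[1/2, 5/4]\<close> and by \<open>\<psi> \<ge> 1/2\<close> beyond,
  so \<open>z\<close> can never be stationary.\<close>

lemma large_gradient:
  fixes z r :: "nat \<Rightarrow> real" and \<psi> :: "real \<Rightarrow> real"
  assumes b: "0 < b" "b \<le> 1/2"
    and \<psi>: "\<And>v. 0 \<le> \<psi> v" "\<And>v. v \<le> 1/2 \<Longrightarrow> 2 * v \<le> \<psi> v" "\<And>v. 5/4 \<le> v \<Longrightarrow> 1/2 \<le> \<psi> v"
    and rec0: "z 1 - z 0 = b * z 0 + b\<^sup>2 * \<psi> (z 0) - r 0"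
    and rec: "\<And>k. Suc k < T \<Longrightarrow> z (Suc (Suc k)) - z (Suc k) = z (Suc k) - z k + b\<^sup>2 * \<psi> (z (Suc k)) - r (Suc k)"
    and T: "1 \<le> T" "z (T - 1) = 1" "z T = 1"
  shows "b ^ 3 / 1024 < (\<Sum>k<T. (r k)\<^sup>2)"
proof (rule ccontr)
  assume "\<not> ?thesis"
  then have tot: "(\<Sum>k<T. (r k)\<^sup>2) \<le> b ^ 3 / 1024" by simp
  define R where "R k = (\<Sum>j<k. (r j)\<^sup>2)" for k
  have R: "R k \<le> b ^ 3 / 1024" if "k \<le> T" for k
  proof -
    have "R k \<le> R T" unfolding R_def using that by (intro sum_mono2) auto
    then show ?thesis using tot by (simp add: R_def)
  qed
  have R_Suc: "R (Suc k) = R k + (r k)\<^sup>2" for k by (simp add: R_def)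
  \<comment> \<open>The value at 0 makes the boundary equation \<open>rec0\<close> an instance of
    the recursion for \<open>s\<close>, and lets \<open>Q\<close> start at 0.\<close>
  define s where "s k = (if k = 0 then b * z 0 else z k - z (k - 1))" for k
  have s_Suc: "s (Suc k) = z (Suc k) - z k" for k by (simp add: s_def)
  have s_rec: "s (Suc k) = s k + b\<^sup>2 * \<psi> (z k) - r k" if "k < T" for k
    using rec0 rec[of "k - 1"] that by (cases k) (auto simp: s_def)
  define p where "p = (LEAST k. 1/2 \<le> z k)"
  have zp: "1/2 \<le> z p" unfolding p_def by (rule LeastI[where k = T]) (simp only: T; simp)
  have pT: "p \<le> T - 1" unfolding p_def by (rule Least_le) (simp only: T; simp)
  have zlt: "z k \<le> 1/2" if "k < p" for k using not_less_Least[of k "\<lambda>k. 1/2 \<le> z k"] that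
    unfolding p_def[symmetric] by simp
  define Q where "Q k = s k - b * z k" for k
  have phase1: "b * (min 0 (Q k))\<^sup>2 \<le> R k" if "k \<le> p" for k
    using that
  proof (induction k)
    case 0 then show ?case by (simp add: Q_def s_def R_def)
  next
    case (Suc k)
    define N where "N = - min 0 (Q k)"
    have N: "0 \<le> N" "- N \<le> Q k" by (auto simp: N_def)
    have kT: "k < T" using Suc.prems pT T by simp
    have "Q (Suc k) = (1 - b) * s (Suc k) - b * z k"
      by (simp add: Q_def s_Suc algebra_simps)
    also have "\<dots> = (1 - b) * Q k + (b\<^sup>2 * ((1 - b) * \<psi> (z k) - z k)) - (1 - b) * r k"
      unfolding s_rec[OF kT] Q_def by (simp add: algebra_simps power2_eq_square)
    finally have QS: "Q (Suc k) = \<dots>" .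
    have "z k \<le> (1 - b) * \<psi> (z k)"
    proof -
      have "1/2 * \<psi> (z k) \<le> (1 - b) * \<psi> (z k)" using b \<psi>(1) by (intro mult_right_mono) auto
      moreover have "2 * z k \<le> \<psi> (z k)" using \<psi>(2) zlt[of k] Suc.prems by simp
      ultimately show ?thesis by linarith
    qed
    then have "0 \<le> b\<^sup>2 * ((1 - b) * \<psi> (z k) - z k)" by simp
    moreover have "(1 - b) * (- N) \<le> (1 - b) * Q k" using N b by (intro mult_left_mono) auto
    moreover have "(1 - b) * r k \<le> (1 - b) * \<bar>r k\<bar>" using b by (intro mult_left_mono) auto
    ultimately have "- ((1 - b) * (N + \<bar>r k\<bar>)) \<le> Q (Suc k)" unfolding QS by (simp add: algebra_simps)
    then have "\<bar>min 0 (Q (Suc k))\<bar> \<le> (1 - b) * (N + \<bar>r k\<bar>)"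
      using mult_nonneg_nonneg[of "1 - b" "N + \<bar>r k\<bar>"] N b by (cases "Q (Suc k) \<le> 0") auto
    then have "(min 0 (Q (Suc k)))\<^sup>2 \<le> ((1 - b) * (N + \<bar>r k\<bar>))\<^sup>2" by (rule power2_le_iff_abs_le[THEN iffD2, rotated]) (use N b in auto)
    then have "b * (min 0 (Q (Suc k)))\<^sup>2 \<le> b * ((1 - b)\<^sup>2 * (N + \<bar>r k\<bar>)\<^sup>2)"
      using b by (intro mult_left_mono) (auto simp: power_mult_distrib)
    \<comment> \<open>Young's inequality with weight b. The factor 1 + b is harmless because the
      contraction supplies (1 - b)^2, and (1 - b)^2 (1 + b) <= 1.\<close>
    also have "b * (N + \<bar>r k\<bar>)\<^sup>2 \<le> (1 + b) * (b * N\<^sup>2 + (r k)\<^sup>2)"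
    proof -
      have "0 \<le> (b * N - \<bar>r k\<bar>)\<^sup>2" by simp
      then have "2 * b * N * \<bar>r k\<bar> \<le> b\<^sup>2 * N\<^sup>2 + (r k)\<^sup>2" by (simp add: power2_diff power_mult_distrib)
      then show ?thesis by (simp add: algebra_simps power2_eq_square)
    qed
    then have "b * ((1 - b)\<^sup>2 * (N + \<bar>r k\<bar>)\<^sup>2) \<le> (1 - b)\<^sup>2 * ((1 + b) * (b * N\<^sup>2 + (r k)\<^sup>2))"
      by (metis mult.left_commute mult_left_mono zero_le_power2)
    also have "\<dots> = ((1 - b) * (1 - b\<^sup>2)) * (b * N\<^sup>2 + (r k)\<^sup>2)"
      by (simp add: algebra_simps power2_eq_square)
    also have "\<dots> \<le> 1 * (b * N\<^sup>2 + (r k)\<^sup>2)"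
      using b by (intro mult_right_mono mult_le_one) (auto simp: power_le_one)
    also have "b * N\<^sup>2 \<le> R k" using Suc by (simp add: N_def)
    finally show ?case by (simp add: R_Suc)
  qed
  have sp: "b/4 \<le> s p"
  proof -
    have "b * (min 0 (Q p))\<^sup>2 \<le> b * (b/32)\<^sup>2"
      using order.trans[OF phase1[of p] R[of p]] pT by (simp add: power2_eq_square power3_eq_cube mult.assoc)
    then have "(min 0 (Q p))\<^sup>2 \<le> (b/32)\<^sup>2" using b by simp
    then have "\<bar>min 0 (Q p)\<bar> \<le> b/32" using b by (simp add: abs_le_square_iff[symmetric])
    then have "- b/32 \<le> Q p" by linarith
    moreover have "b * (1/2) \<le> b * z p" using zp b by (intro mult_left_mono) auto
    ultimately show ?thesis using b unfolding Q_def by linarith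
  qed
  \<comment> \<open>Speed budget after \<open>p\<close>: of the initial b/4, at most b/8 is charged
    to progress, since \<tau> is capped at 1, and at most b/16 to the perturbation, so b/16 always
    remains. The cap is reached only at z = 3/2, so below 5/4 an advance of b/32 still counts in
    full.\<close>
  define \<tau> where "\<tau> v = min (v - 1/2) 1" for v :: real
  have Rb: "64 / b\<^sup>2 * R k \<le> b/16" if "k \<le> T" for k
  proof -
    have "64 / b\<^sup>2 * R k \<le> 64 / b\<^sup>2 * (b ^ 3 / 1024)" using R[OF that] by (intro mult_left_mono) auto
    then show ?thesis using b by (simp add: power2_eq_square power3_eq_cube)
  qed
  have phase2: "1/2 \<le> z k \<and> b/4 - b/8 * \<tau> (z k) - 64 / b\<^sup>2 * R k \<le> s k" if "p \<le> k" "k \<le> T" for k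
    using that
  proof (induction k rule: dec_induct)
    case base
    have "0 \<le> R p" by (simp add: R_def sum_nonneg)
    then have "0 \<le> b/8 * \<tau> (z p)" "0 \<le> 64 / b\<^sup>2 * R p" using zp b by (auto simp: \<tau>_def)
    then show ?case using sp zp by linarith
  next
    case (step k)
    have kT: "k < T" using step by simp
    have IH: "1/2 \<le> z k" "b/4 - b/8 * \<tau> (z k) - 64 / b\<^sup>2 * R k \<le> s k" using step by auto
    have "b/8 * \<tau> (z k) \<le> b/8 * 1" using b by (intro mult_left_mono) (auto simp: \<tau>_def)
    then have sk: "b/16 \<le> s k" using IH Rb[of k] kT by simp
    have "(r k)\<^sup>2 \<le> R (Suc k)" by (simp add: R_Suc) (simp add: R_def sum_nonneg)
    also have "\<dots> \<le> b ^ 3 / 1024" using R kT by simp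
    also have "\<dots> \<le> (b/32)\<^sup>2" using b by (simp add: power2_eq_square power3_eq_cube mult_le_cancel_left1)
    finally have rk: "\<bar>r k\<bar> \<le> b/32" using b by (simp add: abs_le_square_iff[symmetric])
    have p0: "0 \<le> b\<^sup>2 * \<psi> (z k)" using \<psi>(1) by simp
    have s1: "b/32 \<le> s (Suc k)" using sk rk p0 s_rec[OF kT] by linarith
    have zS: "z (Suc k) = z k + s (Suc k)" by (simp add: s_Suc)
    have rr: "64 / b\<^sup>2 * R (Suc k) = 64 / b\<^sup>2 * R k + 64 / b\<^sup>2 * (r k)\<^sup>2" unfolding R_Suc distrib_left ..
    \<comment> \<open>The weights make the first term equal to b/8 * b/32, which is what the
      progress term gains in one step.\<close>
    have amgm: "r k \<le> b\<^sup>2 / 256 + 64 / b\<^sup>2 * (r k)\<^sup>2"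
    proof -
      have "0 \<le> (b / 16 - 8 / b * r k)\<^sup>2" by simp
      also have "\<dots> = b\<^sup>2 / 256 + 64 / b\<^sup>2 * (r k)\<^sup>2 - r k"
        using b by (simp add: power2_diff power_mult_distrib power_divide)
      finally show ?thesis by simp
    qed
    show ?case
    proof (cases "5/4 \<le> z k")
      case True
      have "b/8 * \<tau> (z k) \<le> b/8 * \<tau> (z (Suc k))"
        using b s1 by (intro mult_left_mono) (auto simp: \<tau>_def zS)
      moreover have "b\<^sup>2 / 256 \<le> b\<^sup>2 * \<psi> (z k)"
      proof -
        have "b\<^sup>2 * (1/256) \<le> b\<^sup>2 * \<psi> (z k)" using \<psi>(3)[OF True] by (intro mult_left_mono) auto
        then show ?thesis by simp
      qed
      ultimately have "b/4 - b/8 * \<tau> (z (Suc k)) - 64 / b\<^sup>2 * R (Suc k) \<le> s (Suc k)"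
        using IH amgm s_rec[OF kT] rr by linarith
      then show ?thesis using IH(1) s1 b zS by simp
    next
      case False
      have "b/8 * (\<tau> (z k) + b/32) \<le> b/8 * \<tau> (z (Suc k))"
        using b s1 False by (intro mult_left_mono) (auto simp: \<tau>_def zS)
      then have "b/8 * \<tau> (z k) + b\<^sup>2/256 \<le> b/8 * \<tau> (z (Suc k))"
        by (simp add: algebra_simps power2_eq_square)
      then have "b/4 - b/8 * \<tau> (z (Suc k)) - 64 / b\<^sup>2 * R (Suc k) \<le> s (Suc k)"
        using IH amgm p0 s_rec[OF kT] rr by linarith
      then show ?thesis using IH(1) s1 b zS by simp
    qed
  qed
  have "b/8 * \<tau> (z T) \<le> b/8 * 1" using b by (intro mult_left_mono) (auto simp: \<tau>_def)
  then have "b/16 \<le> s T" using phase2[of T] Rb[of T] pT by linarith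
  moreover have "s T = 0" using T by (simp add: s_def)
  ultimately show False using b by simp
qed

section \<open>Nearest-neighbour chains\<close>

text \<open>Squared differences are stored expanded: their diagonal parts go into the nodal
  functions and only products of neighbours remain. One form then covers both the primal chain and
  the interlaced chain, where dual nodes carry negative curvature.\<close>

definition chain :: "nat \<Rightarrow> (nat \<Rightarrow> real \<Rightarrow> real) \<Rightarrow> (nat \<Rightarrow> real) \<Rightarrow> (nat \<Rightarrow> real) \<Rightarrow> real" where
  "chain n \<phi> E z = (\<Sum>r<Suc n. \<phi> r (z r)) + (\<Sum>r<n. E r * z r * z (Suc r))"

definition chain_grad :: "nat \<Rightarrow> (nat \<Rightarrow> real \<Rightarrow> real) \<Rightarrow> (nat \<Rightarrow> real) \<Rightarrow> (nat \<Rightarrow> real) \<Rightarrow> nat \<Rightarrow> real" where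
  "chain_grad n \<phi>' E z r = \<phi>' r (z r) + (if r < n then E r * z (Suc r) else 0)
     + (if r = 0 then 0 else E (r - 1) * z (r - 1))"

lemma sum_neighbours:
  fixes f :: "nat \<Rightarrow> real"
  shows "(\<Sum>r<Suc n. (if r < n then f (Suc r) else 0)) = (\<Sum>r<n. f (Suc r))"
    and "(\<Sum>r<Suc n. (if r = 0 then 0 else f (r - 1))) = (\<Sum>r<n. f r)"
proof -
  show "(\<Sum>r<Suc n. (if r < n then f (Suc r) else 0)) = (\<Sum>r<n. f (Suc r))" by simp
  show "(\<Sum>r<Suc n. (if r = 0 then 0 else f (r - 1))) = (\<Sum>r<n. f r)"
    by (subst sum.lessThan_Suc_shift) simp
qed

text \<open>The products are bilinear, so their remainder is exactly the product of the increments.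
  By AM-GM each square is charged at most twice with weight K/2, on top of K from its own nodal
  function.\<close>

lemma chain_taylor:
  assumes \<phi>: "\<And>r t h. r \<le> n \<Longrightarrow> \<bar>\<phi> r (t + h) - \<phi> r t - \<phi>' r t * h\<bar> \<le> K * h\<^sup>2"
    and E: "\<And>r. \<bar>E r\<bar> \<le> K"
  shows "\<bar>chain n \<phi> E (\<lambda>i. z i + w i) - chain n \<phi> E z - (\<Sum>r<Suc n. chain_grad n \<phi>' E z r * w r)\<bar>
    \<le> 2 * K * (\<Sum>r<Suc n. (w r)\<^sup>2)"
proof -
  have K: "0 \<le> K" using E[of 0] by simp
  have "(\<Sum>r<Suc n. chain_grad n \<phi>' E z r * w r) = (\<Sum>r<Suc n. \<phi>' r (z r) * w r)
    + (\<Sum>r<Suc n. if r < n then E r * z (Suc r) * w r else 0)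
    + (\<Sum>r<Suc n. if r = 0 then 0 else E (r - 1) * z (r - 1) * w (Suc (r - 1)))"
    unfolding sum.distrib[symmetric] by (intro sum.cong) (auto simp: chain_grad_def algebra_simps)
  also have "\<dots> = (\<Sum>r<Suc n. \<phi>' r (z r) * w r) + (\<Sum>r<n. E r * z (Suc r) * w r)
    + (\<Sum>r<n. E r * z r * w (Suc r))"
    unfolding sum_neighbours(2)[where f = "\<lambda>r. E r * z r * w (Suc r)"] by simp
  finally have "chain n \<phi> E (\<lambda>i. z i + w i) - chain n \<phi> E z - (\<Sum>r<Suc n. chain_grad n \<phi>' E z r * w r)
    = (\<Sum>r<Suc n. \<phi> r (z r + w r) - \<phi> r (z r) - \<phi>' r (z r) * w r)
      + (\<Sum>r<n. E r * (w r * w (Suc r)))"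
    by (simp only: chain_def sum_subtractf) (simp add: algebra_simps sum.distrib)
  also have "\<bar>\<dots>\<bar> \<le> (\<Sum>r<Suc n. K * (w r)\<^sup>2) + (\<Sum>r<n. K * (((w r)\<^sup>2 + (w (Suc r))\<^sup>2) / 2))"
  proof -
    have "\<bar>\<Sum>r<Suc n. \<phi> r (z r + w r) - \<phi> r (z r) - \<phi>' r (z r) * w r\<bar> \<le> (\<Sum>r<Suc n. K * (w r)\<^sup>2)"
      by (rule order.trans[OF sum_abs]) (intro sum_mono \<phi>, simp)
    moreover have "\<bar>\<Sum>r<n. E r * (w r * w (Suc r))\<bar> \<le> (\<Sum>r<n. K * (((w r)\<^sup>2 + (w (Suc r))\<^sup>2) / 2))"
    proof (rule order.trans[OF sum_abs], rule sum_mono)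
      fix r
      have "0 \<le> (\<bar>w r\<bar> - \<bar>w (Suc r)\<bar>)\<^sup>2" by simp
      then have "\<bar>w r * w (Suc r)\<bar> \<le> ((w r)\<^sup>2 + (w (Suc r))\<^sup>2) / 2" by (simp add: power2_diff abs_mult)
      then show "\<bar>E r * (w r * w (Suc r))\<bar> \<le> K * (((w r)\<^sup>2 + (w (Suc r))\<^sup>2) / 2)"
        unfolding abs_mult[of "E r"] using E K by (intro mult_mono) auto
    qed
    ultimately show ?thesis by linarith
  qed
  also have "(\<Sum>r<Suc n. K * (w r)\<^sup>2) = K * (\<Sum>r<Suc n. (w r)\<^sup>2)"
    by (simp only: sum_distrib_left)
  also have "(\<Sum>r<n. K * (((w r)\<^sup>2 + (w (Suc r))\<^sup>2) / 2)) = K / 2 * ((\<Sum>r<n. (w r)\<^sup>2) + (\<Sum>r<n. (w (Suc r))\<^sup>2))"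
    by (simp add: sum.distrib sum_distrib_left algebra_simps add_divide_distrib)
  also have "K * (\<Sum>r<Suc n. (w r)\<^sup>2) + K / 2 * ((\<Sum>r<n. (w r)\<^sup>2) + (\<Sum>r<n. (w (Suc r))\<^sup>2))
      \<le> K * (\<Sum>r<Suc n. (w r)\<^sup>2) + K / 2 * ((\<Sum>r<Suc n. (w r)\<^sup>2) + (\<Sum>r<Suc n. (w r)\<^sup>2))"
  proof (intro add_left_mono mult_left_mono add_mono)
    show "(\<Sum>r<n. (w (Suc r))\<^sup>2) \<le> (\<Sum>r<Suc n. (w r)\<^sup>2)" by (subst sum.lessThan_Suc_shift) simp
  qed (use K in auto)
  also have "K * S + K / 2 * (S + S) = 2 * K * S" for S by simp
  finally show ?thesis .
qed

lemma square_sum3_le: "(a + b + c)\<^sup>2 \<le> 3 * (a\<^sup>2 + b\<^sup>2 + c\<^sup>2)" for a b c :: real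
proof -
  have "0 \<le> (a - b)\<^sup>2 + (b - c)\<^sup>2 + (a - c)\<^sup>2" by simp
  then show ?thesis by (simp add: power2_eq_square algebra_simps)
qed

text \<open>A gradient entry has three terms, which costs a factor 3 when squared, and each node
  occurs in at most three entries, which gives the other 3 of (3 K)^2.\<close>

lemma chain_grad_lipschitz:
  assumes \<phi>: "\<And>r t s. r \<le> n \<Longrightarrow> \<bar>\<phi>' r t - \<phi>' r s\<bar> \<le> K * \<bar>t - s\<bar>"
    and E: "\<And>r. \<bar>E r\<bar> \<le> K"
  shows "(\<Sum>r<Suc n. (chain_grad n \<phi>' E z r - chain_grad n \<phi>' E z' r)\<^sup>2) \<le> (3 * K)\<^sup>2 * (\<Sum>r<Suc n. (z r - z' r)\<^sup>2)"
proof -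
  have K: "0 \<le> K" using E[of 0] by simp
  define w where "w r = (z r - z' r)\<^sup>2" for r
  have Kw: "(E q * (z r - z' r))\<^sup>2 \<le> K\<^sup>2 * w r" for q r
    unfolding power_mult_distrib w_def using E[of q] K by (intro mult_right_mono) (auto simp: abs_le_square_iff[symmetric])
  have "(chain_grad n \<phi>' E z r - chain_grad n \<phi>' E z' r)\<^sup>2
      \<le> 3 * (K\<^sup>2 * w r + (if r < n then K\<^sup>2 * w (Suc r) else 0) + (if r = 0 then 0 else K\<^sup>2 * w (r - 1)))"
    if "r < Suc n" for r
  proof -
    have "chain_grad n \<phi>' E z r - chain_grad n \<phi>' E z' r = (\<phi>' r (z r) - \<phi>' r (z' r))
       + (if r < n then E r * (z (Suc r) - z' (Suc r)) else 0)
       + (if r = 0 then 0 else E (r - 1) * (z (r - 1) - z' (r - 1)))"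
      by (simp add: chain_grad_def algebra_simps)
    moreover have "(\<phi>' r (z r) - \<phi>' r (z' r))\<^sup>2 \<le> K\<^sup>2 * w r"
    proof -
      have "\<bar>\<phi>' r (z r) - \<phi>' r (z' r)\<bar>\<^sup>2 \<le> (K * \<bar>z r - z' r\<bar>)\<^sup>2"
        using \<phi>[of r] that by (intro power_mono) auto
      then show ?thesis by (simp add: power_mult_distrib w_def)
    qed
    moreover have "(if r < n then E r * (z (Suc r) - z' (Suc r)) else 0)\<^sup>2 \<le> (if r < n then K\<^sup>2 * w (Suc r) else 0)"
      using Kw by simp
    moreover have "(if r = 0 then 0 else E (r - 1) * (z (r - 1) - z' (r - 1)))\<^sup>2 \<le> (if r = 0 then 0 else K\<^sup>2 * w (r - 1))"
      using Kw by simp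
    ultimately show ?thesis by (simp only:) (rule order.trans[OF square_sum3_le], intro mult_left_mono add_mono, auto)
  qed
  then have "(\<Sum>r<Suc n. (chain_grad n \<phi>' E z r - chain_grad n \<phi>' E z' r)\<^sup>2)
     \<le> (\<Sum>r<Suc n. 3 * (K\<^sup>2 * w r + (if r < n then K\<^sup>2 * w (Suc r) else 0) + (if r = 0 then 0 else K\<^sup>2 * w (r - 1))))"
    by (intro sum_mono) auto
  also have "\<dots> = 3 * ((\<Sum>r<Suc n. K\<^sup>2 * w r) + (\<Sum>r<n. K\<^sup>2 * w (Suc r)) + (\<Sum>r<n. K\<^sup>2 * w r))"
    unfolding sum_distrib_left[symmetric] sum.distrib sum_neighbours(1)[where f = "\<lambda>r. K\<^sup>2 * w r"]
      sum_neighbours(2)[where f = "\<lambda>r. K\<^sup>2 * w r"] ..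
  also have "\<dots> \<le> 3 * ((\<Sum>r<Suc n. K\<^sup>2 * w r) + (\<Sum>r<Suc n. K\<^sup>2 * w r) + (\<Sum>r<Suc n. K\<^sup>2 * w r))"
  proof (intro mult_left_mono add_mono order_refl)
    show "(\<Sum>r<n. K\<^sup>2 * w (Suc r)) \<le> (\<Sum>r<Suc n. K\<^sup>2 * w r)"
      by (subst sum.lessThan_Suc_shift) (simp add: w_def)
  qed (auto simp: w_def)
  also have "\<dots> = (3 * K)\<^sup>2 * (\<Sum>r<Suc n. w r)"
    by (simp only: sum_distrib_left[symmetric] power_mult_distrib) simp
  finally show ?thesis by (simp add: w_def)
qed

section \<open>Norms, gradients from quadratic remainder bounds, and uniqueness of gradients\<close>

lemma enorm_power2: "(enorm d v)\<^sup>2 = (\<Sum>i<d. (v i)\<^sup>2)"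
  by (simp add: enorm_def ip_def sum_nonneg power2_eq_square)

lemma enorm_eq: "enorm d v = sqrt (\<Sum>i<d. (v i)\<^sup>2)"
  by (simp add: enorm_def ip_def power2_eq_square)

lemma enorm_nonneg: "0 \<le> enorm d v"
  by (simp add: enorm_eq sum_nonneg)

lemma has_gradI:
  assumes "G \<in> vec d" "0 \<le> K"
    "\<And>h. h \<in> vec d \<Longrightarrow> \<bar>g (vadd x h) - g x - ip d G h\<bar> \<le> K * (\<Sum>i<d. (h i)\<^sup>2)"
  shows "has_grad d g G x"
  unfolding has_grad_def
proof (intro conjI allI impI assms(1))
  fix e :: real assume e: "0 < e"
  show "\<exists>\<delta>>0. \<forall>h\<in>vec d. enorm d h < \<delta> \<longrightarrow> \<bar>g (vadd x h) - g x - ip d G h\<bar> \<le> e * enorm d h"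
  proof (intro exI[of _ "e / (K + 1)"] conjI ballI impI)
    show "0 < e / (K + 1)" using e assms(2) by simp
    fix h assume h: "h \<in> vec d" "enorm d h < e / (K + 1)"
    have "\<bar>g (vadd x h) - g x - ip d G h\<bar> \<le> (K * enorm d h) * enorm d h"
      using assms(3)[OF h(1)] by (simp add: enorm_power2[symmetric]) (simp add: power2_eq_square)
    also have "\<dots> \<le> e * enorm d h"
    proof (intro mult_right_mono enorm_nonneg)
      have "(K + 1) * enorm d h \<le> e" using h(2) assms(2) by (simp add: field_simps)
      then show "K * enorm d h \<le> e" using enorm_nonneg[of d h] by (simp add: algebra_simps)
    qed
    finally show "\<bar>g (vadd x h) - g x - ip d G h\<bar> \<le> e * enorm d h" .
  qed
qed

lemma has_grad2I:
  assumes "Gx \<in> vec dx" "Gy \<in> vec dy" "0 \<le> K"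
    "\<And>h k. h \<in> vec dx \<Longrightarrow> k \<in> vec dy \<Longrightarrow>
      \<bar>f (vadd x h) (vadd y k) - f x y - ip dx Gx h - ip dy Gy k\<bar> \<le> K * ((\<Sum>i<dx. (h i)\<^sup>2) + (\<Sum>i<dy. (k i)\<^sup>2))"
  shows "has_grad2 dx dy f Gx Gy x y"
  unfolding has_grad2_def
proof (intro conjI allI impI assms(1,2))
  fix e :: real assume e: "0 < e"
  define nm where "nm h k = sqrt ((enorm dx h)\<^sup>2 + (enorm dy k)\<^sup>2)" for h k
  have nm: "0 \<le> nm h k" "(\<Sum>i<dx. (h i)\<^sup>2) + (\<Sum>i<dy. (k i)\<^sup>2) = nm h k * nm h k" for h k
    by (simp_all add: nm_def flip: enorm_power2)
  have "\<exists>\<delta>>0. \<forall>h\<in>vec dx. \<forall>k\<in>vec dy. nm h k < \<delta> \<longrightarrow>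
      \<bar>f (vadd x h) (vadd y k) - f x y - ip dx Gx h - ip dy Gy k\<bar> \<le> e * nm h k"
  proof (intro exI[of _ "e / (K + 1)"] conjI ballI impI)
    show "0 < e / (K + 1)" using e assms(3) by simp
    fix h k assume h: "h \<in> vec dx" "k \<in> vec dy" "nm h k < e / (K + 1)"
    have "\<bar>f (vadd x h) (vadd y k) - f x y - ip dx Gx h - ip dy Gy k\<bar> \<le> (K * nm h k) * nm h k"
      using assms(4)[OF h(1,2)] by (simp add: nm(2))
    also have "\<dots> \<le> e * nm h k"
    proof (intro mult_right_mono nm(1))
      have "(K + 1) * nm h k \<le> e" using h(3) assms(3) by (simp add: field_simps)
      then show "K * nm h k \<le> e" using nm(1)[of h k] by (simp add: algebra_simps)
    qed
    finally show "\<bar>f (vadd x h) (vadd y k) - f x y - ip dx Gx h - ip dy Gy k\<bar> \<le> e * nm h k" .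
  qed
  then show "\<exists>\<delta>>0. \<forall>h\<in>vec dx. \<forall>k\<in>vec dy.
        sqrt ((enorm dx h)\<^sup>2 + (enorm dy k)\<^sup>2) < \<delta> \<longrightarrow>
        \<bar>f (vadd x h) (vadd y k) - f x y - ip dx Gx h - ip dy Gy k\<bar>
          \<le> e * sqrt ((enorm dx h)\<^sup>2 + (enorm dy k)\<^sup>2)"
    unfolding nm_def .
qed

text \<open>The theorem speaks about every gradient of \<open>Phi\<close> at an iterate; uniqueness
  identifies it with the explicit one. Inside the dimension, a short step along one axis compares
  the entries; outside, both vanish by membership in \<open>vec\<close>.\<close>

lemma has_grad_unique:
  assumes "has_grad d g G x" "has_grad d g G' x" shows "G = G'"
proof
  fix i
  show "G i = G' i"
  proof (cases "i < d")
    case False then show ?thesis using assms by (auto simp: has_grad_def vec_def)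
  next
    case True
    have "\<bar>G i - G' i\<bar> \<le> 0 + e" if e: "0 < e" for e
    proof -
      obtain \<delta> \<delta>' where d: "0 < \<delta>" "0 < \<delta>'"
        "\<And>h. h \<in> vec d \<Longrightarrow> enorm d h < \<delta> \<Longrightarrow> \<bar>g (vadd x h) - g x - ip d G h\<bar> \<le> e / 2 * enorm d h"
        "\<And>h. h \<in> vec d \<Longrightarrow> enorm d h < \<delta>' \<Longrightarrow> \<bar>g (vadd x h) - g x - ip d G' h\<bar> \<le> e / 2 * enorm d h"
        using assms e unfolding has_grad_def by (metis half_gt_zero)
      define t where "t = min \<delta> \<delta>' / 2"
      have t: "0 < t" "t < \<delta>" "t < \<delta>'" using d by (auto simp: t_def min_def)
      define h where "h = (\<lambda>j. if j = i then t else 0)"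
      have h: "h \<in> vec d" using True by (auto simp: h_def vec_def)
      have ip: "ip d v h = v i * t" for v
        using True by (simp add: ip_def h_def if_distrib[of "\<lambda>u. _ * u"] sum.delta cong: if_cong)
      have n: "enorm d h = t" using t by (simp add: enorm_def ip) (simp add: h_def)
      have "\<bar>g (vadd x h) - g x - G i * t\<bar> \<le> e / 2 * t" "\<bar>g (vadd x h) - g x - G' i * t\<bar> \<le> e / 2 * t"
        using d(3,4)[OF h] t by (simp_all add: n ip)
      then have "\<bar>G i * t - G' i * t\<bar> \<le> e * t" by linarith
      then have "\<bar>G i - G' i\<bar> * t \<le> e * t" using t by (simp add: left_diff_distrib[symmetric] abs_mult)
      then show ?thesis using t by simp
    qed
    then have "\<bar>G i - G' i\<bar> \<le> 0" by (rule field_le_epsilon)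
    then show ?thesis by simp
  qed
qed

section \<open>Paths of dual variables\<close>

text \<open>Position \<open>i (m + 1)\<close> of the chain holds \<open>x\<^sub>i\<close>, and the \<open>m\<close> positions after it hold the \<open>i\<close>-th block of \<open>y\<close>.
  For \<open>m = 0\<close> there is no \<open>y\<close>, and the chain is \<open>x\<close> itself.\<close>

definition join :: "nat \<Rightarrow> (nat \<Rightarrow> real) \<Rightarrow> (nat \<Rightarrow> real) \<Rightarrow> nat \<Rightarrow> real" where
  "join m x y r = (if r mod Suc m = 0 then x (r div Suc m) else y (r div Suc m * m + r mod Suc m - 1))"

definition posx :: "nat \<Rightarrow> nat \<Rightarrow> nat" where "posx m i = i * Suc m"
text \<open>In front of the dual entry j stand j other dual entries and \<open>j div m + 1\<close>
  primal ones.\<close>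

definition posy :: "nat \<Rightarrow> nat \<Rightarrow> nat" where "posy m j = Suc (j + j div m)"

lemma posy_block: "k < m \<Longrightarrow> posy m (i * m + k) = i * Suc m + Suc k"
  by (simp add: posy_def)

lemma posy_mod_div: "0 < m \<Longrightarrow> posy m j = j div m * Suc m + Suc (j mod m)"
  using posy_block[of "j mod m" m "j div m"] by simp

lemma join_posx [simp]: "join m x y (posx m i) = x i"
  by (simp add: join_def posx_def del: mult_Suc_right)

lemma join_posy [simp]: assumes "0 < m" shows "join m x y (posy m j) = y j"
proof -
  have k: "Suc (j mod m) < Suc m" using assms by simp
  have "(j div m * Suc m + Suc (j mod m)) mod Suc m = Suc (j mod m)"
    "(j div m * Suc m + Suc (j mod m)) div Suc m = j div m"
    using mod_less[OF k] div_less[OF k] by (simp_all only: mod_mult_self3 div_mult_self3)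
  then show ?thesis unfolding join_def posy_mod_div[OF assms] by simp
qed

lemma join_block:
  "join m x y (i * Suc m) = x i"
  "k < m \<Longrightarrow> join m x y (i * Suc m + Suc k) = y (i * m + k)"
  "join m x y (i * Suc m + Suc m) = x (Suc i)"
proof -
  show "join m x y (i * Suc m) = x i" using join_posx[of m x y i] unfolding posx_def .
  show "join m x y (i * Suc m + Suc k) = y (i * m + k)" if "k < m"
    using join_posy[of m x y "i * m + k"] that unfolding posy_block[OF that] by simp
  have "i * Suc m + Suc m = Suc i * Suc m" by simp
  then show "join m x y (i * Suc m + Suc m) = x (Suc i)"
    using join_posx[of m x y "Suc i"] unfolding posx_def by metis
qed

lemma position_cases:
  obtains i where "r = posx m i" | j where "0 < m" "r = posy m j"
proof (cases "r mod Suc m")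
  case 0 then have "r = posx m (r div Suc m)" unfolding posx_def by (metis add.right_neutral div_mult_mod_eq)
  then show ?thesis using that by blast
next
  case (Suc k)
  then have k: "k < m" using mod_less_divisor[of "Suc m" r] by simp
  have "r = posy m (r div Suc m * m + k)"
    unfolding posy_block[OF k] Suc[symmetric] by (metis div_mult_mod_eq)
  then show ?thesis using that k by (metis gr_implies_not0 gr0I)
qed

lemma join_0: "join 0 x y = x"
  by (rule ext) (simp add: join_def)

lemma sum_lessThan_add:
  fixes f :: "nat \<Rightarrow> 'a::comm_monoid_add"
  shows "sum f {..<a + b} = sum f {..<a} + (\<Sum>k<b. f (a + k))"
  by (induction b) (simp_all add: add.assoc)

lemma sum_positions:
  fixes f :: "nat \<Rightarrow> real"
  shows "(\<Sum>r<Suc (T * Suc m). f r) = (\<Sum>i<Suc T. f (posx m i)) + (\<Sum>j<T * m. f (posy m j))"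
proof (induction T)
  case 0 then show ?case by (simp add: posx_def)
next
  case (Suc T)
  have e: "Suc (Suc T * Suc m) = Suc (T * Suc m) + Suc m" "Suc T * m = T * m + m" by simp_all
  have "(\<Sum>r<Suc (Suc T * Suc m). f r) = (\<Sum>r<Suc (T * Suc m). f r) + (\<Sum>k<Suc m. f (Suc (T * Suc m) + k))"
    unfolding e by (rule sum_lessThan_add)
  also have "(\<Sum>k<Suc m. f (Suc (T * Suc m) + k)) = (\<Sum>k<m. f (posy m (T * m + k))) + f (posx m (Suc T))"
    by (simp add: posy_block) (simp add: posx_def ac_simps)
  finally show ?case unfolding Suc e(2) sum_lessThan_add by simp
qed

text \<open>The mass is \<open>\<rho> + 1/\<rho> - 2\<close> for \<open>\<rho> = 1 + 1/m\<close>, so \<open>modefun\<close>, which is \<open>\<rho>\<^sup>K + \<rho>\<^sup>1\<^sup>-\<^sup>K\<close>, is an explicit solution of the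
  three-term recurrence with a reflecting left end. The constants \<open>port\<close> and \<open>load\<close> are calibrated so that maximizing a
  link over its block of \<open>y\<close> gives exactly \<open>(s - t)\<^sup>2 / 2\<close>.\<close>

definition rho :: "nat \<Rightarrow> real" where "rho m = 1 + 1 / real m"
definition mass :: "nat \<Rightarrow> real" where "mass m = 1 / (real m * real (Suc m))"
definition modefun :: "nat \<Rightarrow> nat \<Rightarrow> real" where "modefun m K = rho m ^ K + rho m / rho m ^ K"
definition slope :: "nat \<Rightarrow> real" where "slope m = modefun m (Suc m) - modefun m m"
definition port :: "nat \<Rightarrow> real" where "port m = sqrt (slope m / modefun m 1)"
definition load :: "nat \<Rightarrow> real" where "load m = modefun m m / modefun m 1"

lemma rho_gt_1: "0 < m \<Longrightarrow> 1 < rho m"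
  by (simp add: rho_def)

lemma modefun_rec:
  assumes "0 < m"
  shows "modefun m K + modefun m (Suc (Suc K)) = (2 + mass m) * modefun m (Suc K)"
proof -
  have r: "rho m \<noteq> 0" "rho m > 0" using rho_gt_1[OF assms] by auto
  have "2 + mass m = rho m + 1 / rho m"
  proof -
    have "2 + 1 / (x * (x + 1)) = 1 + 1 / x + 1 / (1 + 1 / x)" if "0 < x" for x :: real
    proof -
      have "1 / (1 + 1 / x) = x / (x + 1)" using that by (simp add: field_simps)
      then show ?thesis using that by (simp add: divide_simps) (simp add: algebra_simps)
    qed
    from this[of "real m"] show ?thesis using assms by (simp add: mass_def rho_def add.commute)
  qed
  moreover have "(x + q / x) + (q * (q * x) + q / (q * (q * x))) = (q + 1 / q) * (q * x + q / (q * x))"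
    if "q > 0" "x > 0" for q x :: real
    using that by (simp add: field_simps)
  ultimately show ?thesis using r by (simp add: modefun_def)
qed

text \<open>The reflecting end: the exponents K and 1 - K trade places at K = 0 and K = 1.\<close>

lemma modefun_0_1: "0 < m \<Longrightarrow> modefun m 0 = modefun m 1"
  using rho_gt_1[of m] by (simp add: modefun_def)

lemma modefun_1_ge: "0 < m \<Longrightarrow> 2 \<le> modefun m 1"
  using rho_gt_1[of m] by (simp add: modefun_def)

lemma slope_eq: "0 < m \<Longrightarrow> slope m = (rho m - 1) * (rho m ^ m - 1 / rho m ^ m)"
  using rho_gt_1[of m] by (simp add: slope_def modefun_def field_simps)

text \<open>This is the reason for a mass of order 1/m^2: over a block of length m the mode grows by
  at most the factor e, so \<open>slope\<close>, \<open>port\<close> and \<open>load\<close> are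
  bounded independently of m, and so is the smoothness constant.\<close>

lemma rho_power_le: "0 < m \<Longrightarrow> rho m ^ m \<le> 3"
proof -
  assume m: "0 < m"
  have "rho m \<le> exp (1 / real m)" by (simp add: rho_def exp_ge_add_one_self)
  then have "rho m ^ m \<le> exp (1 / real m) ^ m" using rho_gt_1[OF m] by (intro power_mono) auto
  also have "\<dots> = exp 1" using m by (simp add: exp_of_nat_mult[symmetric])
  finally show ?thesis using exp_le by linarith
qed

lemma slope_bounds: assumes "0 < m" shows "0 < slope m" "slope m \<le> 3"
proof -
  have 1: "1 < rho m ^ m" using rho_gt_1[OF assms] assms by (intro one_less_power) auto
  then have 2: "1 / rho m ^ m < 1" "0 < 1 / rho m ^ m" by (simp_all add: divide_simps)
  show "0 < slope m" unfolding slope_eq[OF assms] using rho_gt_1[OF assms] 1 2 by (intro mult_pos_pos) linarith+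
  have "slope m \<le> 1 * 3" unfolding slope_eq[OF assms]
  proof (intro mult_mono)
    show "rho m - 1 \<le> 1" using assms by (simp add: rho_def)
  qed (use 1 2 rho_power_le[OF assms] in linarith)+
  then show "slope m \<le> 3" by simp
qed

lemma port_bounds: assumes "0 < m" shows "0 < port m" "port m \<le> 2"
proof -
  have "slope m / modefun m 1 \<le> 2\<^sup>2"
    using slope_bounds[OF assms] modefun_1_ge[OF assms] by (simp add: divide_le_eq)
  then have "port m \<le> sqrt (2\<^sup>2)" unfolding port_def by (rule real_sqrt_le_mono)
  then show "port m \<le> 2" by simp
  show "0 < port m" unfolding port_def using slope_bounds[OF assms] modefun_1_ge[OF assms] by simp
qed

lemma load_bounds: assumes "0 < m" shows "0 \<le> load m" "load m \<le> 2"
proof -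
  have 1: "1 \<le> rho m ^ m" using rho_gt_1[OF assms] by (intro one_le_power) auto
  have "rho m / rho m ^ m \<le> 1"
    using self_le_power[of "rho m" m] rho_gt_1[OF assms] assms 1 by (simp add: divide_le_eq)
  then have "modefun m m \<le> 4" using rho_power_le[OF assms] by (simp add: modefun_def)
  then show "load m \<le> 2" using modefun_1_ge[OF assms] by (simp add: load_def divide_le_eq)
  show "0 \<le> load m" using rho_gt_1[OF assms] modefun_1_ge[OF assms] by (simp add: load_def modefun_def)
qed

text \<open>The Dirichlet form of a path with free ends plus a mass term. On constant vectors only
  the mass survives, so it alone fixes the concavity modulus in y.\<close>

definition bil :: "nat \<Rightarrow> (nat \<Rightarrow> real) \<Rightarrow> (nat \<Rightarrow> real) \<Rightarrow> real" where
  "bil m v w = (\<Sum>k<m - 1. (v k - v (Suc k)) * (w k - w (Suc k))) + mass m * (\<Sum>k<m. v k * w k)"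

definition link :: "nat \<Rightarrow> real \<Rightarrow> real \<Rightarrow> (nat \<Rightarrow> real) \<Rightarrow> real" where
  "link m s t w = (if m = 0 then (s - t)\<^sup>2 / 2
     else (1 - load m) / 2 * (s\<^sup>2 + t\<^sup>2) + port m * s * w 0 - port m * t * w (m - 1) - bil m w w / 2)"

text \<open>The response of the path to a source of strength \<open>port m * s\<close> at its first
  node and \<open>- port m * t\<close> at its last. Each mode reflects at the end opposite to its
  source, hence the mirrored index in the term with s.\<close>

definition link_opt :: "nat \<Rightarrow> real \<Rightarrow> real \<Rightarrow> nat \<Rightarrow> real" where
  "link_opt m s t k = port m / slope m * (s * modefun m (m - k) - t * modefun m (Suc k))"

text \<open>The sequence \<open>W\<close> is shifted by one against \<open>v\<close>, which leaves room for ghost values at both ends.\<close>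

lemma summation_by_parts:
  fixes v W :: "nat \<Rightarrow> real"
  assumes "\<And>k. k \<le> n \<Longrightarrow> W k + W (Suc (Suc k)) = (2 + p) * W (Suc k)"
  shows "(\<Sum>k<n. (v k - v (Suc k)) * (W (Suc k) - W (Suc (Suc k)))) + p * (\<Sum>k<Suc n. v k * W (Suc k))
    = v 0 * (W 0 - W 1) + v n * (W (Suc (Suc n)) - W (Suc n))"
  using assms
proof (induction n)
  case 0
  have W: "W (Suc (Suc 0)) = (2 + p) * W (Suc 0) - W 0" using 0[of 0] by simp
  show ?case by (simp add: W algebra_simps)
next
  case (Suc n)
  have W: "W (Suc (Suc (Suc n))) = (2 + p) * W (Suc (Suc n)) - W (Suc n)" using Suc.prems[of "Suc n"] by simp
  have "(v n - v (Suc n)) * (W (Suc n) - W (Suc (Suc n))) + p * (v (Suc n) * W (Suc (Suc n)))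
      = v (Suc n) * (W (Suc (Suc (Suc n))) - W (Suc (Suc n))) - v n * (W (Suc (Suc n)) - W (Suc n))"
    by (simp add: W algebra_simps)
  then show ?case using Suc.IH Suc.prems by (simp add: distrib_left)
qed

text \<open>Weak form of the stationarity equation in w. The shifted sequence \<open>W\<close>
  includes ghost values at 0 and m + 1: across each end one mode has no jump and the other has jump
  \<open>slope m\<close>, which the prefactor turns into the source.\<close>

lemma bil_link_opt:
  assumes "0 < m"
  shows "bil m v (link_opt m s t) = port m * s * v 0 - port m * t * v (m - 1)"
proof -
  obtain n where n: "m = Suc n" using assms by (cases m) auto
  define W where "W K = port m / slope m * (s * modefun m (Suc m - K) - t * modefun m K)" for K
  have s0: "slope m \<noteq> 0" using slope_bounds[OF assms] by simp
  have rec: "W k + W (Suc (Suc k)) = (2 + mass m) * W (Suc k)" if "k \<le> n" for k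
  proof -
    have "Suc m - k = Suc (Suc (n - k))" "Suc m - Suc k = Suc (n - k)" "Suc m - Suc (Suc k) = n - k"
      using that by (auto simp: n)
    moreover have "a * (s * A - t * B) + a * (s * A' - t * B') = a * (s * (A' + A) - t * (B + B'))" for a A B A' B'
      by (simp add: algebra_simps)
    moreover have g: "a * (s * (c * A) - t * (c * B)) = c * (a * (s * A - t * B))" for a c A B :: real
      by (simp add: algebra_simps)
    ultimately show ?thesis unfolding W_def
      by (simp only: modefun_rec[OF assms] g)
  qed
  have W: "W (Suc k) = link_opt m s t k" for k by (simp add: W_def link_opt_def)
  have "bil m v (link_opt m s t) = v 0 * (W 0 - W 1) + v n * (W (Suc (Suc n)) - W (Suc n))"
    using summation_by_parts[of n W "mass m" v, OF rec] by (simp add: bil_def W n)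
  moreover have "W 0 - W 1 = port m * s"
  proof -
    have "W 0 - W 1 = port m / slope m * (s * slope m)"
      using modefun_0_1[OF assms] unfolding W_def slope_def by (simp add: right_diff_distrib)
    then show ?thesis using s0 by simp
  qed
  moreover have "W (Suc (Suc n)) - W (Suc n) = - port m * t"
  proof -
    have "W (Suc (Suc n)) - W (Suc n) = port m / slope m * (- t * slope m)"
      using modefun_0_1[OF assms] unfolding W_def slope_def by (simp add: n right_diff_distrib)
    then show ?thesis using s0 by simp
  qed
  ultimately show ?thesis by (simp add: n algebra_simps)
qed

lemma bil_diff: "bil m (\<lambda>k. v k - w k) (\<lambda>k. v k - w k) = bil m v v - 2 * bil m v w + bil m w w"
proof -
  have "((v k - w k) - (v (Suc k) - w (Suc k))) * ((v k - w k) - (v (Suc k) - w (Suc k)))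
    = (v k - v (Suc k)) * (v k - v (Suc k)) - 2 * ((v k - v (Suc k)) * (w k - w (Suc k)))
      + (w k - w (Suc k)) * (w k - w (Suc k))" "(v k - w k) * (v k - w k) = v k * v k - 2 * (v k * w k) + w k * w k" for k
    by (simp_all add: algebra_simps)
  then show ?thesis unfolding bil_def
    by (simp only: sum.distrib sum_subtractf sum_distrib_left[symmetric]) (simp add: algebra_simps)
qed

lemma bil_nonneg: "0 \<le> bil m v v"
  unfolding bil_def mass_def by (intro add_nonneg_nonneg mult_nonneg_nonneg[of "1 / _"] sum_nonneg) auto

text \<open>By stationarity the linear part equals \<open>bil m w (link_opt m s t)\<close>, so the
  maximum adds half the energy of the optimizer. That energy is load (s^2 + t^2) - 2 s t: the square
  of \<open>port\<close> normalizes the cross term, and the coefficient 1 - load supplies the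
  missing diagonal part.\<close>

lemma link_complete_square:
  assumes "0 < m"
  shows "link m s t w = (s - t)\<^sup>2 / 2 - bil m (\<lambda>k. w k - link_opt m s t k) (\<lambda>k. w k - link_opt m s t k) / 2"
proof -
  have s0: "slope m > 0" "modefun m 1 > 0" using slope_bounds[OF assms] modefun_1_ge[OF assms] by auto
  have p2: "port m * port m = slope m / modefun m 1"
    using s0 by (simp add: port_def)
  have o1: "port m * link_opt m s t 0 = load m * s - t"
  proof -
    have "port m * link_opt m s t 0 = (port m * port m) / slope m * (s * modefun m m - t * modefun m 1)"
      by (simp add: link_opt_def)
    then show ?thesis unfolding p2 load_def using s0 by (simp add: field_simps)
  qed
  have o2: "port m * link_opt m s t (m - 1) = s - load m * t"
  proof -
    have "port m * link_opt m s t (m - 1) = (port m * port m) / slope m * (s * modefun m 1 - t * modefun m m)"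
      using assms by (simp add: link_opt_def)
    then show ?thesis unfolding p2 load_def using s0 by (simp add: field_simps)
  qed
  have "bil m (link_opt m s t) (link_opt m s t) = s * (port m * link_opt m s t 0) - t * (port m * link_opt m s t (m - 1))"
    unfolding bil_link_opt[OF assms] by simp
  also have "\<dots> = load m * (s\<^sup>2 + t\<^sup>2) - 2 * s * t"
    unfolding o1 o2 by (simp add: algebra_simps power2_eq_square)
  finally have q: "bil m (link_opt m s t) (link_opt m s t) = \<dots>" .
  show ?thesis unfolding bil_diff q unfolding bil_link_opt[OF assms] link_def
    using assms by (simp add: field_simps power2_eq_square)
qed

lemma link_le: "link m s t w \<le> (s - t)\<^sup>2 / 2"
  using bil_nonneg by (cases "m = 0") (auto simp: link_complete_square, simp add: link_def)

lemma link_opt_eq: "(\<And>k. k < m \<Longrightarrow> w k = link_opt m s t k) \<Longrightarrow> link m s t w = (s - t)\<^sup>2 / 2"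
  by (cases "m = 0") (auto simp: link_complete_square bil_def, simp add: link_def)

section \<open>Assembling the interlaced chain from its blocks\<close>

text \<open>Stiffness and coupling are the diagonal and off-diagonal entries of the tridiagonal Hessian of the quadratic part.
  With \<open>m = 0\<close> they describe the primal function \<open>\<Phi>\<close> itself.\<close>

definition stiff :: "nat \<Rightarrow> nat \<Rightarrow> nat \<Rightarrow> real" where
  "stiff m T r = (if r mod Suc m = 0
     then (if m = 0 then 1 else 1 - load m) * ((if r = 0 then 0 else 1) + (if r = T * Suc m then 0 else 1))
     else - (mass m + (if r mod Suc m = 1 then 0 else 1) + (if r mod Suc m = m then 0 else 1)))"

definition coupling :: "nat \<Rightarrow> nat \<Rightarrow> real" where
  "coupling m r = (if m = 0 then - 1 else if r mod Suc m = 0 then port m else if r mod Suc m = m then - port m else 1)"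

definition nodal :: "nat \<Rightarrow> nat \<Rightarrow> real \<Rightarrow> nat \<Rightarrow> real \<Rightarrow> real" where
  "nodal m T b r t = stiff m T r / 2 * t\<^sup>2 + (if r = 0 then b / 2 * (t - 1)\<^sup>2 else 0)
     + (if r mod Suc m = 0 then b\<^sup>2 * pot t else 0)"

definition nodal' :: "nat \<Rightarrow> nat \<Rightarrow> real \<Rightarrow> nat \<Rightarrow> real \<Rightarrow> real" where
  "nodal' m T b r t = stiff m T r * t + (if r = 0 then b * (t - 1) else 0)
     + (if r mod Suc m = 0 then b\<^sup>2 * pot' t else 0)"

lemma mass_bounds: "0 \<le> mass m" "mass m \<le> 1"
proof -
  show "0 \<le> mass m" by (simp add: mass_def)
  show "mass m \<le> 1"
  proof (cases m)
    case (Suc n)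
    have "1 \<le> m * Suc m" using Suc by simp
    then have "1 \<le> real m * real (Suc m)" by (metis of_nat_1 of_nat_le_iff of_nat_mult)
    then show ?thesis by (simp add: mass_def divide_le_eq)
  qed (simp add: mass_def)
qed

lemma stiff_bound: "\<bar>stiff m T r\<bar> \<le> 3"
  using mass_bounds[of m] load_bounds[of m] by (cases "m = 0") (auto simp: stiff_def)

lemma coupling_bound: "\<bar>coupling m r\<bar> \<le> 2"
  using port_bounds[of m] by (auto simp: coupling_def)

lemma nodal_deriv: "(nodal m T b r has_real_derivative nodal' m T b r t) (at t)"
  unfolding nodal_def[abs_def] nodal'_def
  by (cases "r = 0"; cases "r mod Suc m = 0") (auto intro!: derivative_eq_intros pot_deriv)

text \<open>The sum 14 = 3 + 1 + 10 collects the stiffness, the boundary spring, and the potential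
  with 40 b^2 <= 10.\<close>

lemma lipschitz_nodal':
  assumes "0 < b" "b \<le> 1/2"
  shows "\<bar>nodal' m T b r t - nodal' m T b r s\<bar> \<le> 14 * \<bar>t - s\<bar>"
proof -
  have "\<bar>stiff m T r * (t - s)\<bar> \<le> 3 * \<bar>t - s\<bar>"
    unfolding abs_mult using stiff_bound by (intro mult_right_mono) auto
  moreover have "\<bar>if r = 0 then b * (t - s) else 0\<bar> \<le> 1 * \<bar>t - s\<bar>"
    using assms by (auto simp: abs_mult intro: mult_right_mono[of b 1, simplified])
  moreover have "\<bar>if r mod Suc m = 0 then b\<^sup>2 * (pot' t - pot' s) else 0\<bar> \<le> 10 * \<bar>t - s\<bar>"
  proof -
    have "b\<^sup>2 \<le> (1/2)\<^sup>2" using assms by (intro power_mono) auto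
    then have "b\<^sup>2 * \<bar>pot' t - pot' s\<bar> \<le> 1/4 * (40 * \<bar>t - s\<bar>)"
      using lipschitz_pot'[of t s] by (intro mult_mono) (auto simp: power2_eq_square)
    then show ?thesis by (simp add: abs_mult)
  qed
  moreover have "nodal' m T b r t - nodal' m T b r s = stiff m T r * (t - s) + (if r = 0 then b * (t - s) else 0)
     + (if r mod Suc m = 0 then b\<^sup>2 * (pot' t - pot' s) else 0)"
    by (simp add: nodal'_def algebra_simps)
  ultimately show ?thesis by linarith
qed

definition base :: "nat \<Rightarrow> real \<Rightarrow> (nat \<Rightarrow> real) \<Rightarrow> real" where
  "base T b x = b / 2 * (x 0 - 1)\<^sup>2 + b\<^sup>2 * (\<Sum>i<Suc T. pot (x i))"

text \<open>The weight is the degree of a node in a path, so a sum over nodes becomes a sum over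
  edges.\<close>

lemma sum_split_ends:
  fixes g :: "nat \<Rightarrow> real"
  shows "(\<Sum>k<Suc n. ((if k = 0 then 0 else 1) + (if k = n then 0 else 1)) * g k) = (\<Sum>k<n. g k + g (Suc k))"
proof -
  have "(\<Sum>k<Suc n. ((if k = 0 then 0 else 1) + (if k = n then 0 else 1)) * g k)
    = (\<Sum>k<Suc n. (if k < n then g k else 0)) + (\<Sum>k<Suc n. if k = 0 then 0 else g (Suc (k - 1)))"
    unfolding sum.distrib[symmetric] by (intro sum.cong) auto
  also have "\<dots> = (\<Sum>k<n. g k) + (\<Sum>k<n. g (Suc k))"
    unfolding sum_neighbours(2)[where f = "\<lambda>k. g (Suc k)"] by simp
  finally show ?thesis by (simp add: sum.distrib)
qed

lemma block_energy:
  assumes "0 < m"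
  shows "(1 - load m) / 2 * (s\<^sup>2 + t\<^sup>2)
      + (\<Sum>k<m. - (mass m + (if k = 0 then 0 else 1) + (if Suc k = m then 0 else 1)) / 2 * (w k)\<^sup>2)
      + (port m * s * w 0 + (\<Sum>k<m - 1. w k * w (Suc k)) - port m * w (m - 1) * t) = link m s t w"
proof -
  obtain n where n: "m = Suc n" using assms by (cases m) auto
  have arith: "- (M / 2) * A - 1/2 * (B + 2 * C) = - (B + M * A) / 2 - C" for M A B C :: real
    by (simp add: field_simps)
  have "(\<Sum>k<m. - (mass m + (if k = 0 then 0 else 1) + (if Suc k = m then 0 else 1)) / 2 * (w k)\<^sup>2)
    = - (mass m / 2) * (\<Sum>k<Suc n. (w k)\<^sup>2)
      - 1/2 * (\<Sum>k<Suc n. ((if k = 0 then 0 else 1) + (if k = n then 0 else 1)) * (w k)\<^sup>2)"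
    unfolding n sum_distrib_left sum_subtractf[symmetric]
    by (intro sum.cong refl) (simp add: field_simps)
  also have "\<dots> = - (mass m / 2) * (\<Sum>k<Suc n. (w k)\<^sup>2) - 1/2 * (\<Sum>k<n. (w k)\<^sup>2 + (w (Suc k))\<^sup>2)"
    unfolding sum_split_ends ..
  also have "(\<Sum>k<n. (w k)\<^sup>2 + (w (Suc k))\<^sup>2)
    = (\<Sum>k<n. (w k - w (Suc k)) * (w k - w (Suc k))) + 2 * (\<Sum>k<n. w k * w (Suc k))"
    unfolding sum_distrib_left sum.distrib[symmetric]
    by (intro sum.cong refl) (simp add: algebra_simps power2_eq_square)
  finally have "(\<Sum>k<m. - (mass m + (if k = 0 then 0 else 1) + (if Suc k = m then 0 else 1)) / 2 * (w k)\<^sup>2)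
    = - bil m w w / 2 - (\<Sum>k<m - 1. w k * w (Suc k))"
    unfolding bil_def by (simp only: n diff_Suc_1 power2_eq_square) (rule arith)
  then show ?thesis using assms by (simp only: link_def) simp
qed

text \<open>The bridge between two views of one function: as a nearest-neighbour chain it has
  bounded derivatives and propagates support slowly; as a base term plus links on disjoint blocks of
  y it can be maximized explicitly.\<close>

lemma chain_join:
  "chain (T * Suc m) (nodal m T b) (coupling m) (join m x y)
    = base T b x + (\<Sum>i<T. link m (x i) (x (Suc i)) (\<lambda>k. y (i * m + k)))"
proof -
  define z where "z = join m x y"
  define dc where "dc = (if m = 0 then 1 else 1 - load m)"
  define w where "w i k = y (i * m + k)" for i k
  define q where "q k = (mass m + (if k = 0 then 0 else 1) + (if Suc k = m then 0 else 1))" for k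
  have zx: "z (i * Suc m) = x i" "z (i * Suc m + Suc m) = x (Suc i)" for i unfolding z_def by (simp_all only: join_block)
  have zy: "z (i * Suc m + Suc k) = w i k" if "k < m" for i k
    unfolding z_def w_def by (rule join_block(2)[OF that])
  have posx_mod: "posx m i mod Suc m = 0" "posx m i = 0 \<longleftrightarrow> i = 0" for i by (auto simp: posx_def simp del: mult_Suc_right)
  have posy_mod: "posy m j mod Suc m = Suc (j mod m)" if "0 < m" for j
  proof -
    have "Suc (j mod m) < Suc m" using that by simp
    then show ?thesis unfolding posy_mod_div[OF that] by (metis mod_less mod_mult_self3)
  qed
  have "(\<Sum>i<Suc T. nodal m T b (posx m i) (z (posx m i)))
    = base T b x + dc / 2 * (\<Sum>i<Suc T. ((if i = 0 then 0 else 1) + (if i = T then 0 else 1)) * (x i)\<^sup>2)"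
  proof -
    have "(\<Sum>i<Suc T. nodal m T b (posx m i) (z (posx m i)))
      = (\<Sum>i<Suc T. dc / 2 * (((if i = 0 then 0 else 1) + (if i = T then 0 else 1)) * (x i)\<^sup>2)
          + b\<^sup>2 * pot (x i) + (if i = 0 then b / 2 * (x 0 - 1)\<^sup>2 else 0))"
    proof (intro sum.cong refl)
      fix i
      have "posx m i = T * Suc m \<longleftrightarrow> i = T" unfolding posx_def by (metis mult_cancel2 nat.distinct(1))
      then show "nodal m T b (posx m i) (z (posx m i)) = dc / 2 * (((if i = 0 then 0 else 1) + (if i = T then 0 else 1)) * (x i)\<^sup>2)
          + b\<^sup>2 * pot (x i) + (if i = 0 then b / 2 * (x 0 - 1)\<^sup>2 else 0)"
        using posx_mod[of i] unfolding nodal_def stiff_def dc_def z_def by simp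
    qed
    also have "(\<Sum>i<Suc T. (if i = 0 then b / 2 * (x 0 - 1)\<^sup>2 else 0)) = b / 2 * (x 0 - 1)\<^sup>2"
      by (subst sum.delta) auto
    ultimately show ?thesis by (simp only: sum.distrib sum_distrib_left base_def)
  qed
  also have "\<dots> = base T b x + (\<Sum>i<T. dc / 2 * ((x i)\<^sup>2 + (x (Suc i))\<^sup>2))"
    unfolding sum_split_ends sum_distrib_left ..
  finally have 1: "(\<Sum>i<Suc T. nodal m T b (posx m i) (z (posx m i))) = \<dots>" .
  have 2: "(\<Sum>j<T * m. nodal m T b (posy m j) (z (posy m j))) = (\<Sum>i<T. \<Sum>k<m. - q k / 2 * (w i k)\<^sup>2)"
  proof (cases "m = 0")
    case False
    have "(\<Sum>j<T * m. nodal m T b (posy m j) (z (posy m j))) = (\<Sum>i<T. \<Sum>k<m. nodal m T b (posy m (i * m + k)) (z (posy m (i * m + k))))"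
      unfolding sum.nat_group[symmetric, of _ m T] by (subst sum.nat_group[symmetric]) (simp add: sum.atLeastLessThan_shift_0 atLeast0LessThan)
    also have "\<dots> = (\<Sum>i<T. \<Sum>k<m. - q k / 2 * (w i k)\<^sup>2)"
    proof (intro sum.cong refl)
      fix i k assume "k \<in> {..<m}"
      then have k: "k < m" by simp
      have "posy m (i * m + k) mod Suc m = Suc k" using posy_mod[of "i * m + k"] k by simp
      moreover have "z (posy m (i * m + k)) = w i k" unfolding posy_block[OF k] by (rule zy[OF k])
      moreover have "posy m (i * m + k) \<noteq> 0" by (simp add: posy_def)
      ultimately show "nodal m T b (posy m (i * m + k)) (z (posy m (i * m + k))) = - q k / 2 * (w i k)\<^sup>2"
        unfolding nodal_def stiff_def q_def by simp
    qed
    finally show ?thesis .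
  qed simp
  have 3: "(\<Sum>r<T * Suc m. coupling m r * z r * z (Suc r)) = (\<Sum>i<T. \<Sum>k<Suc m. coupling m k * z (i * Suc m + k) * z (i * Suc m + Suc k))"
  proof -
    have "(\<Sum>r<T * Suc m. coupling m r * z r * z (Suc r)) = (\<Sum>i<T. \<Sum>k<Suc m. coupling m (i * Suc m + k) * z (i * Suc m + k) * z (Suc (i * Suc m + k)))"
      by (subst sum.nat_group[symmetric]) (simp only: sum.atLeastLessThan_shift_0 atLeast0LessThan add_diff_cancel_left' comp_def)
    \<comment> \<open>Couplings repeat with period m + 1, so the bonds split into T identical
      blocks.\<close>
    moreover have "coupling m (i * Suc m + k) = coupling m k" for i k
      unfolding coupling_def by (simp only: mod_mult_self3)
    ultimately show ?thesis by (simp only: add_Suc_right)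
  qed
  have 4: "dc / 2 * ((x i)\<^sup>2 + (x (Suc i))\<^sup>2) + (\<Sum>k<m. - q k / 2 * (w i k)\<^sup>2)
      + (\<Sum>k<Suc m. coupling m k * z (i * Suc m + k) * z (i * Suc m + Suc k)) = link m (x i) (x (Suc i)) (w i)" for i
  proof (cases m)
    case 0
    then show ?thesis using zx[of i] by (simp add: dc_def link_def coupling_def power2_diff field_simps)
  next
    case (Suc n)
    have mp: "0 < m" using Suc by simp
    have "(\<Sum>k<Suc m. coupling m k * z (i * Suc m + k) * z (i * Suc m + Suc k))
      = coupling m 0 * z (i * Suc m + 0) * z (i * Suc m + Suc 0)
        + (\<Sum>k<n. coupling m (Suc k) * z (i * Suc m + Suc k) * z (i * Suc m + Suc (Suc k)))
        + coupling m m * z (i * Suc m + m) * z (i * Suc m + Suc m)"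
      unfolding sum.lessThan_Suc[where n = m] unfolding Suc sum.lessThan_Suc_shift ..
    also have "(\<Sum>k<n. coupling m (Suc k) * z (i * Suc m + Suc k) * z (i * Suc m + Suc (Suc k))) = (\<Sum>k<n. w i k * w i (Suc k))"
    proof (intro sum.cong refl)
      fix k assume "k \<in> {..<n}"
      then have k: "k < m" "Suc k < m" by (auto simp: Suc)
      then have "coupling m (Suc k) = 1" by (simp add: coupling_def)
      then show "coupling m (Suc k) * z (i * Suc m + Suc k) * z (i * Suc m + Suc (Suc k)) = w i k * w i (Suc k)"
        unfolding zy[OF k(1)] zy[OF k(2)] by simp
    qed
    also have "z (i * Suc m + m) = w i n" using zy[of n i] Suc by simp
    finally show ?thesis
      unfolding zx zy[OF mp] add_0_right using block_energy[OF mp, of "x i" "x (Suc i)" "w i"] Suc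
      by (simp add: coupling_def dc_def q_def)
  qed
  show ?thesis
    unfolding chain_def z_def[symmetric] sum_positions 1 2 3 w_def[symmetric] 4[symmetric] sum.distrib by simp
qed

section \<open>The hard instance\<close>

lemma join_vadd: "join m (vadd x h) (vadd y k) = (\<lambda>r. join m x y r + join m h k r)"
  by (rule ext) (simp add: join_def vadd_def)

lemma join_scale: "(\<lambda>r. join m x y r / c) = join m (\<lambda>i. x i / c) (\<lambda>j. y j / c)"
  by (rule ext) (simp add: join_def)

lemma sum_join_power2:
  "(\<Sum>r<Suc (T * Suc m). (join m x y r)\<^sup>2) = (\<Sum>i<Suc T. (x i)\<^sup>2) + (\<Sum>j<T * m. (y j)\<^sup>2)"
proof -
  have "(\<Sum>j<T * m. (join m x y (posy m j))\<^sup>2) = (\<Sum>j<T * m. (y j)\<^sup>2)"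
    by (cases "m = 0") auto
  then show ?thesis unfolding sum_positions by simp
qed

section \<open>Strong concavity in the dual variables\<close>

lemma square_concave:
  fixes u v \<tau> :: real
  shows "(\<tau> * u + (1 - \<tau>) * v) * (\<tau> * u + (1 - \<tau>) * v) = \<tau> * (u * u) + (1 - \<tau>) * (v * v) - \<tau> * (1 - \<tau>) * ((u - v) * (u - v))"
  by (simp add: algebra_simps)

lemma bil_convex:
  "bil m (\<lambda>k. \<tau> * u k + (1 - \<tau>) * v k) (\<lambda>k. \<tau> * u k + (1 - \<tau>) * v k)
    = \<tau> * bil m u u + (1 - \<tau>) * bil m v v - \<tau> * (1 - \<tau>) * bil m (\<lambda>k. u k - v k) (\<lambda>k. u k - v k)"
proof -
  have e: "\<tau> * u k + (1 - \<tau>) * v k - (\<tau> * u (Suc k) + (1 - \<tau>) * v (Suc k))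
     = \<tau> * (u k - u (Suc k)) + (1 - \<tau>) * (v k - v (Suc k))"
    "u k - v k - (u (Suc k) - v (Suc k)) = (u k - u (Suc k)) - (v k - v (Suc k))" for k
    by (simp_all add: algebra_simps)
  show ?thesis unfolding bil_def e square_concave
    by (simp only: sum.distrib sum_subtractf sum_distrib_left[symmetric]) (simp add: algebra_simps)
qed

lemma bil_ge: "mass m * (\<Sum>k<m. (v k)\<^sup>2) \<le> bil m v v"
  by (simp add: bil_def power2_eq_square sum_nonneg)

text \<open>For a quadratic the Jensen defect is exactly \<tau> (1 - \<tau>) / 2 times
  \<open>bil\<close> of the difference, and terms affine in w drop out; \<open>bil_ge\<close> bounds
  it below by the mass.\<close>

lemma link_concave:
  assumes "0 \<le> \<tau>" "\<tau> \<le> 1" "0 < m"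
  shows "\<tau> * link m s t u + (1 - \<tau>) * link m s t v + \<tau> * (1 - \<tau>) / 2 * (mass m * (\<Sum>k<m. (u k - v k)\<^sup>2))
    \<le> link m s t (\<lambda>k. \<tau> * u k + (1 - \<tau>) * v k)"
proof -
  have "\<tau> * (1 - \<tau>) / 2 * (mass m * (\<Sum>k<m. (u k - v k)\<^sup>2)) \<le> \<tau> * (1 - \<tau>) / 2 * bil m (\<lambda>k. u k - v k) (\<lambda>k. u k - v k)"
    using assms by (intro mult_left_mono bil_ge) auto
  moreover have "\<tau> * link m s t u + (1 - \<tau>) * link m s t v + \<tau> * (1 - \<tau>) / 2 * bil m (\<lambda>k. u k - v k) (\<lambda>k. u k - v k)
    = link m s t (\<lambda>k. \<tau> * u k + (1 - \<tau>) * v k)"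
    using assms unfolding link_def bil_convex by (simp add: field_simps)
  ultimately show ?thesis by linarith
qed

lemma sum_blocks:
  fixes g :: "nat \<Rightarrow> real"
  shows "(\<Sum>j<T * m. g j) = (\<Sum>i<T. \<Sum>k<m. g (i * m + k))"
  by (subst sum.nat_group[symmetric]) (simp only: sum.atLeastLessThan_shift_0 atLeast0LessThan add_diff_cancel_left' comp_def)

text \<open>\<open>lam\<close> is the curvature scale and \<open>sig\<close> the length scale:
  values scale with lam sig^2, gradients with lam sig, Hessians with lam, and Lipschitz constants of
  Hessians with lam / sig.\<close>

locale hard_instance =
  fixes lam sig b :: real and T :: nat
  assumes lam: "0 < lam" and sig: "0 < sig" and b: "0 < b" "b \<le> 1/2" and T: "1 \<le> T"
begin

lemma sig_ne_0 [simp]: "sig \<noteq> 0"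
  using sig by simp

definition energy :: "nat \<Rightarrow> (nat \<Rightarrow> real) \<Rightarrow> real" where
  "energy m z = lam * sig\<^sup>2 * chain (T * Suc m) (nodal m T b) (coupling m) (\<lambda>r. z r / sig)"

definition egrad :: "nat \<Rightarrow> (nat \<Rightarrow> real) \<Rightarrow> nat \<Rightarrow> real" where
  "egrad m z r = chain_grad (T * Suc m) (\<lambda>r t. lam * sig * nodal' m T b r (t / sig)) (\<lambda>r. lam * coupling m r) z r"

lemma scaled_nodal_lipschitz:
  "\<bar>lam * sig * nodal' m T b r (t / sig) - lam * sig * nodal' m T b r (s / sig)\<bar> \<le> 14 * lam * \<bar>t - s\<bar>"
proof -
  have "\<bar>nodal' m T b r (t / sig) - nodal' m T b r (s / sig)\<bar> \<le> 14 * \<bar>t / sig - s / sig\<bar>"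
    by (rule lipschitz_nodal'[OF b])
  then have "lam * sig * \<bar>nodal' m T b r (t / sig) - nodal' m T b r (s / sig)\<bar> \<le> lam * sig * (14 * \<bar>t / sig - s / sig\<bar>)"
    using lam sig by (intro mult_left_mono) auto
  also have "\<bar>t / sig - s / sig\<bar> = \<bar>t - s\<bar> / sig" using sig by (simp flip: diff_divide_distrib)
  also have "lam * sig * (14 * (\<bar>t - s\<bar> / sig)) = 14 * lam * \<bar>t - s\<bar>" using sig by simp
  finally show ?thesis using lam sig by (simp add: abs_mult flip: right_diff_distrib)
qed

lemma scaled_coupling_bound: "\<bar>lam * coupling m r\<bar> \<le> 14 * lam"
  using coupling_bound[of m r] lam by (simp add: abs_mult)

lemma energy_taylor:
  "\<bar>energy m (\<lambda>r. z r + w r) - energy m z - (\<Sum>r<Suc (T * Suc m). egrad m z r * w r)\<bar>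
    \<le> 28 * lam * (\<Sum>r<Suc (T * Suc m). (w r)\<^sup>2)"
proof -
  have e: "energy m z = chain (T * Suc m) (\<lambda>r t. lam * sig\<^sup>2 * nodal m T b r (t / sig)) (\<lambda>r. lam * coupling m r) z" for z
    unfolding energy_def chain_def distrib_left sum_distrib_left
    using sig by (intro arg_cong2[where f = "(+)"] sum.cong) (auto simp: power2_eq_square)
  have d: "((\<lambda>t. lam * sig\<^sup>2 * nodal m T b r (t / sig)) has_real_derivative lam * sig * nodal' m T b r (t / sig)) (at t)" for r t
  proof -
    have "((\<lambda>t. nodal m T b r (t / sig)) has_real_derivative nodal' m T b r (t / sig) * (1 / sig)) (at t)"
      by (rule DERIV_chain2[OF nodal_deriv]) (auto intro!: derivative_eq_intros)
    from DERIV_cmult[OF this, of "lam * sig\<^sup>2"] show ?thesis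
      using sig by (simp add: power2_eq_square mult.assoc mult.commute mult.left_commute)
  qed
  show ?thesis
    unfolding e egrad_def
    using chain_taylor[of "T * Suc m" "\<lambda>r t. lam * sig\<^sup>2 * nodal m T b r (t / sig)"
        "\<lambda>r t. lam * sig * nodal' m T b r (t / sig)" "14 * lam" "\<lambda>r. lam * coupling m r" z w]
      taylor_of_lipschitz_deriv[OF d scaled_nodal_lipschitz] scaled_coupling_bound by simp
qed

lemma egrad_lipschitz:
  "(\<Sum>r<Suc (T * Suc m). (egrad m z r - egrad m z' r)\<^sup>2) \<le> (42 * lam)\<^sup>2 * (\<Sum>r<Suc (T * Suc m). (z r - z' r)\<^sup>2)"
  unfolding egrad_def
  using chain_grad_lipschitz[of "T * Suc m" "\<lambda>r t. lam * sig * nodal' m T b r (t / sig)" "14 * lam" "\<lambda>r. lam * coupling m r" z z']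
    scaled_nodal_lipschitz scaled_coupling_bound by simp

definition obj :: "nat \<Rightarrow> (nat \<Rightarrow> real) \<Rightarrow> (nat \<Rightarrow> real) \<Rightarrow> real" where
  "obj m x y = energy m (join m x y)"

definition grad_x :: "nat \<Rightarrow> (nat \<Rightarrow> real) \<Rightarrow> (nat \<Rightarrow> real) \<Rightarrow> nat \<Rightarrow> real" where
  "grad_x m x y i = (if i < Suc T then egrad m (join m x y) (posx m i) else 0)"

definition grad_y :: "nat \<Rightarrow> (nat \<Rightarrow> real) \<Rightarrow> (nat \<Rightarrow> real) \<Rightarrow> nat \<Rightarrow> real" where
  "grad_y m x y j = (if j < T * m then egrad m (join m x y) (posy m j) else 0)"

lemma smooth_obj: "smooth_with_grad (Suc T) (T * m) (obj m) (grad_x m) (grad_y m) (42 * lam)"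
  unfolding smooth_with_grad_def
proof (intro conjI ballI)
  fix x y assume "x \<in> vec (Suc T)" "y \<in> vec (T * m)"
  show "has_grad2 (Suc T) (T * m) (obj m) (grad_x m x y) (grad_y m x y) x y"
  proof (rule has_grad2I[where K = "28 * lam"])
    fix h k assume "h \<in> vec (Suc T)" "k \<in> vec (T * m)"
    have "(\<Sum>j<T * m. egrad m (join m x y) (posy m j) * join m h k (posy m j)) = ip (T * m) (grad_y m x y) k"
      by (cases "m = 0") (auto simp: ip_def grad_y_def)
    then have "(\<Sum>r<Suc (T * Suc m). egrad m (join m x y) r * join m h k r)
      = ip (Suc T) (grad_x m x y) h + ip (T * m) (grad_y m x y) k"
      unfolding sum_positions by (simp only: join_posx) (simp add: ip_def grad_x_def)
    then show "\<bar>obj m (vadd x h) (vadd y k) - obj m x y - ip (Suc T) (grad_x m x y) h - ip (T * m) (grad_y m x y) k\<bar>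
      \<le> 28 * lam * ((\<Sum>i<Suc T. (h i)\<^sup>2) + (\<Sum>j<T * m. (k j)\<^sup>2))"
      using energy_taylor[of m "join m x y" "join m h k"]
      unfolding obj_def join_vadd sum_join_power2 by (simp only: diff_diff_eq)
  qed (use lam in \<open>auto simp: vec_def grad_x_def grad_y_def\<close>)
next
  fix x y x' y' :: "nat \<Rightarrow> real"
  have j: "join m x y r - join m x' y' r = join m (vsub x x') (vsub y y') r" for r by (simp add: join_def vsub_def)
  have "(\<Sum>r<Suc (T * Suc m). (egrad m (join m x y) r - egrad m (join m x' y') r)\<^sup>2)
    = (enorm (Suc T) (vsub (grad_x m x y) (grad_x m x' y')))\<^sup>2 + (enorm (T * m) (vsub (grad_y m x y) (grad_y m x' y')))\<^sup>2"
    unfolding sum_positions enorm_power2 by (simp add: grad_x_def grad_y_def vsub_def)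
  moreover have "(\<Sum>r<Suc (T * Suc m). (join m x y r - join m x' y' r)\<^sup>2)
    = (enorm (Suc T) (vsub x x'))\<^sup>2 + (enorm (T * m) (vsub y y'))\<^sup>2"
    unfolding j sum_join_power2 enorm_power2 ..
  ultimately have "(enorm (Suc T) (vsub (grad_x m x y) (grad_x m x' y')))\<^sup>2 + (enorm (T * m) (vsub (grad_y m x y) (grad_y m x' y')))\<^sup>2
    \<le> (42 * lam)\<^sup>2 * ((enorm (Suc T) (vsub x x'))\<^sup>2 + (enorm (T * m) (vsub y y'))\<^sup>2)"
    using egrad_lipschitz[of m "join m x y" "join m x' y'"] by simp
  then have "sqrt ((enorm (Suc T) (vsub (grad_x m x y) (grad_x m x' y')))\<^sup>2 + (enorm (T * m) (vsub (grad_y m x y) (grad_y m x' y')))\<^sup>2)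
    \<le> sqrt ((42 * lam)\<^sup>2 * ((enorm (Suc T) (vsub x x'))\<^sup>2 + (enorm (T * m) (vsub y y'))\<^sup>2))"
    by (rule real_sqrt_le_mono)
  then show "sqrt ((enorm (Suc T) (vsub (grad_x m x y) (grad_x m x' y')))\<^sup>2 + (enorm (T * m) (vsub (grad_y m x y) (grad_y m x' y')))\<^sup>2)
    \<le> 42 * lam * sqrt ((enorm (Suc T) (vsub x x'))\<^sup>2 + (enorm (T * m) (vsub y y'))\<^sup>2)"
    using lam by (simp add: real_sqrt_mult)
qed

lemma obj_blocks:
  "obj m x y = lam * sig\<^sup>2 * (base T b (\<lambda>i. x i / sig)
     + (\<Sum>i<T. link m (x i / sig) (x (Suc i) / sig) (\<lambda>k. y (i * m + k) / sig)))"
  unfolding obj_def energy_def join_scale chain_join ..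

lemma energy_blocks:
  "energy 0 x = lam * sig\<^sup>2 * (base T b (\<lambda>i. x i / sig) + (\<Sum>i<T. (x i / sig - x (Suc i) / sig)\<^sup>2 / 2))"
  using obj_blocks[of 0 x x] by (simp add: obj_def join_0 link_def)

text \<open>The blocks of y are disjoint, so the links are maximized separately, and the supremum is
  attained. The result is the chain with m = 0, whatever the m of the saddle problem.\<close>

lemma Phi_obj: "Phi (T * m) (obj m) = energy 0"
proof
  fix x
  define y where "y j = (if j < T * m then sig * link_opt m (x (j div m) / sig) (x (Suc (j div m)) / sig) (j mod m) else 0)" for j
  have "y \<in> vec (T * m)" by (simp add: vec_def y_def)
  moreover have "obj m x y = energy 0 x"
  proof -
    have "link m (x i / sig) (x (Suc i) / sig) (\<lambda>k. y (i * m + k) / sig) = (x i / sig - x (Suc i) / sig)\<^sup>2 / 2" if "i < T" for i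
    proof (rule link_opt_eq)
      fix k assume k: "k < m"
      have "i * m + k < Suc i * m" using k by simp
      also have "\<dots> \<le> T * m" using that by (intro mult_le_mono1) simp
      finally show "y (i * m + k) / sig = link_opt m (x i / sig) (x (Suc i) / sig) k"
        using k sig by (simp add: y_def)
    qed
    then have "(\<Sum>i<T. link m (x i / sig) (x (Suc i) / sig) (\<lambda>k. y (i * m + k) / sig)) = (\<Sum>i<T. (x i / sig - x (Suc i) / sig)\<^sup>2 / 2)"
      by (intro sum.cong) auto
    then show ?thesis unfolding obj_blocks energy_blocks by simp
  qed
  moreover have "obj m x y' \<le> energy 0 x" for y'
    unfolding obj_blocks energy_blocks using lam by (intro mult_left_mono add_left_mono sum_mono link_le) auto
  ultimately show "Phi (T * m) (obj m) x = energy 0 x"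
    unfolding Phi_def by (intro cSup_eq_maximum) (auto intro!: image_eqI)
qed

text \<open>Each block has modulus \<open>lam * mass m\<close>, since the length scale cancels. For
  m = 0 the dual space is a point and every modulus is admissible.\<close>

lemma strongly_concave_obj:
  assumes "m = 0 \<or> \<mu> \<le> lam * mass m"
  shows "strongly_concave_y (Suc T) (T * m) (obj m) \<mu>"
  unfolding strongly_concave_y_def concave_vec_def
proof (intro ballI allI impI)
  fix x u v :: "nat \<Rightarrow> real" and \<tau> :: real assume \<tau>: "0 \<le> \<tau> \<and> \<tau> \<le> 1"
  define w where "w = (\<lambda>i. \<tau> * u i + (1 - \<tau>) * v i)"
  show "\<tau> * (obj m x u + \<mu> / 2 * (enorm (T * m) u)\<^sup>2) + (1 - \<tau>) * (obj m x v + \<mu> / 2 * (enorm (T * m) v)\<^sup>2)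
    \<le> obj m x (\<lambda>i. \<tau> * u i + (1 - \<tau>) * v i) + \<mu> / 2 * (enorm (T * m) (\<lambda>i. \<tau> * u i + (1 - \<tau>) * v i))\<^sup>2"
  proof (cases "m = 0")
    case True then show ?thesis by (simp add: obj_def join_0 enorm_power2 algebra_simps)
  next
    case False
    define D where "D = (\<Sum>j<T * m. (u j - v j)\<^sup>2)"
    define L where "L y i = link m (x i / sig) (x (Suc i) / sig) (\<lambda>k. y (i * m + k) / sig)" for y i
    have n: "(enorm (T * m) w)\<^sup>2 = \<tau> * (enorm (T * m) u)\<^sup>2 + (1 - \<tau>) * (enorm (T * m) v)\<^sup>2 - \<tau> * (1 - \<tau>) * D"
      unfolding enorm_power2 D_def w_def unfolding power2_eq_square square_concave
      by (simp only: sum.distrib sum_subtractf sum_distrib_left[symmetric])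
    have "\<tau> * L u i + (1 - \<tau>) * L v i + \<tau> * (1 - \<tau>) / 2 * (mass m * (\<Sum>k<m. (u (i * m + k) - v (i * m + k))\<^sup>2 / sig\<^sup>2)) \<le> L w i" for i
      using link_concave[of \<tau> m "x i / sig" "x (Suc i) / sig" "\<lambda>k. u (i * m + k) / sig" "\<lambda>k. v (i * m + k) / sig"] \<tau> False
      by (simp add: L_def w_def add_divide_distrib power_divide flip: diff_divide_distrib)
    then have "(\<Sum>i<T. \<tau> * L u i + (1 - \<tau>) * L v i + \<tau> * (1 - \<tau>) / 2 * (mass m * (\<Sum>k<m. (u (i * m + k) - v (i * m + k))\<^sup>2 / sig\<^sup>2))) \<le> (\<Sum>i<T. L w i)"
      by (intro sum_mono)
    then have "\<tau> * sum (L u) {..<T} + (1 - \<tau>) * sum (L v) {..<T} + \<tau> * (1 - \<tau>) / 2 * (mass m * (D / sig\<^sup>2)) \<le> sum (L w) {..<T}"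
      unfolding D_def sum_blocks by (simp add: sum.distrib sum_distrib_left sum_divide_distrib)
    then have "lam * sig\<^sup>2 * (base T b (\<lambda>i. x i / sig) + (\<tau> * sum (L u) {..<T} + (1 - \<tau>) * sum (L v) {..<T} + \<tau> * (1 - \<tau>) / 2 * (mass m * (D / sig\<^sup>2)))) \<le> obj m x w"
      unfolding obj_blocks L_def[symmetric] using lam by (intro mult_left_mono add_left_mono) auto
    also have "lam * sig\<^sup>2 * (base T b (\<lambda>i. x i / sig) + (\<tau> * sum (L u) {..<T} + (1 - \<tau>) * sum (L v) {..<T} + \<tau> * (1 - \<tau>) / 2 * (mass m * (D / sig\<^sup>2))))
      = \<tau> * obj m x u + (1 - \<tau>) * obj m x v + \<tau> * (1 - \<tau>) / 2 * (lam * mass m) * D"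
      unfolding obj_blocks L_def[symmetric] using sig by (simp add: field_simps)
    finally have "\<tau> * obj m x u + (1 - \<tau>) * obj m x v + \<tau> * (1 - \<tau>) / 2 * (lam * mass m) * D \<le> obj m x w" .
    moreover have "\<tau> * (1 - \<tau>) / 2 * \<mu> * D \<le> \<tau> * (1 - \<tau>) / 2 * (lam * mass m) * D"
      using assms \<tau> False by (intro mult_right_mono mult_left_mono) (auto simp: D_def sum_nonneg)
    ultimately show ?thesis unfolding w_def[symmetric] n by (simp add: field_simps)
  qed
qed

definition hess :: "(nat \<Rightarrow> real) \<Rightarrow> nat \<Rightarrow> nat \<Rightarrow> real" where
  "hess x i j = (if j = i then lam * (stiff 0 T i + (if i = 0 then b else 0) + b\<^sup>2 * pot'' (x i / sig)) else 0)
     + (if j = Suc i \<and> i < T then - lam else 0) + (if Suc j = i then - lam else 0)"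

lemma egrad_0:
  "egrad 0 x i = lam * (stiff 0 T i * x i + (if i = 0 then b * (x i - sig) else 0) + sig * b\<^sup>2 * pot' (x i / sig))
     - (if i < T then lam * x (Suc i) else 0) - (if i = 0 then 0 else lam * x (i - 1))"
  using sig by (simp add: egrad_def chain_grad_def nodal'_def coupling_def field_simps power2_eq_square)

lemma ip_hess:
  assumes "i < Suc T"
  shows "ip (Suc T) (hess x i) v = lam * (stiff 0 T i + (if i = 0 then b else 0) + b\<^sup>2 * pot'' (x i / sig)) * v i
    - (if i < T then lam * v (Suc i) else 0) - (if i = 0 then 0 else lam * v (i - 1))"
proof -
  define d where "d = lam * (stiff 0 T i + (if i = 0 then b else 0) + b\<^sup>2 * pot'' (x i / sig))"
  have "hess x i j * v j = (if j = i then d * v i else 0)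
    + (if j = Suc i then (if i < T then - lam * v (Suc i) else 0) else 0)
    + (if j = i - 1 then (if i = 0 then 0 else - lam * v (i - 1)) else 0)" for j
    unfolding hess_def d_def[symmetric] by (cases "j = i"; cases "j = Suc i"; cases "Suc j = i") auto
  then have "ip (Suc T) (hess x i) v = (\<Sum>j<Suc T. if j = i then d * v i else 0)
    + (\<Sum>j<Suc T. if j = Suc i then (if i < T then - lam * v (Suc i) else 0) else 0)
    + (\<Sum>j<Suc T. if j = i - 1 then (if i = 0 then 0 else - lam * v (i - 1)) else 0)"
    unfolding ip_def by (simp only: sum.distrib)
  also have "\<dots> = d * v i + (if i < T then - lam * v (Suc i) else 0) + (if i = 0 then 0 else - lam * v (i - 1))"
    using assms by (simp only: sum.delta finite_lessThan lessThan_iff) auto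
  finally show ?thesis unfolding d_def by simp
qed

lemma has_grad_energy: "has_grad (Suc T) (energy 0) (\<lambda>i. if i < Suc T then egrad 0 x i else 0) x"
proof (rule has_gradI[where K = "28 * lam"])
  fix h
  show "\<bar>energy 0 (vadd x h) - energy 0 x - ip (Suc T) (\<lambda>i. if i < Suc T then egrad 0 x i else 0) h\<bar>
    \<le> 28 * lam * (\<Sum>i<Suc T. (h i)\<^sup>2)"
    using energy_taylor[of 0 x h] by (simp add: vadd_def ip_def)
qed (use lam in \<open>auto simp: vec_def\<close>)

text \<open>Only the diagonal of the Hessian depends on x, so a difference of two Hessians acts
  coordinatewise and the constant does not grow with the dimension.\<close>

lemma hessian_lipschitz_energy: "hessian_lipschitz (Suc T) (energy 0) (220 * lam * b\<^sup>2 / sig)"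
  unfolding hessian_lipschitz_def
proof (intro exI[of _ "\<lambda>x i. if i < Suc T then egrad 0 x i else 0"]
    exI[of _ "\<lambda>x i j. if j < Suc T then hess x i j else 0"] conjI ballI allI impI)
  fix x
  show "has_grad (Suc T) (energy 0) (\<lambda>i. if i < Suc T then egrad 0 x i else 0) x"
    by (rule has_grad_energy)
  fix i assume i: "i < Suc T"
  show "has_grad (Suc T) (\<lambda>z. if i < Suc T then egrad 0 z i else 0) (\<lambda>j. if j < Suc T then hess x i j else 0) x"
  proof (rule has_gradI[where K = "220 * lam * b\<^sup>2 / sig"])
    fix h :: "nat \<Rightarrow> real"
    have ip: "ip (Suc T) (\<lambda>j. if j < Suc T then hess x i j else 0) h = ip (Suc T) (hess x i) h"
      by (simp add: ip_def)
    have "egrad 0 (vadd x h) i - egrad 0 x i - ip (Suc T) (hess x i) h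
      = lam * sig * b\<^sup>2 * (pot' (x i / sig + h i / sig) - pot' (x i / sig) - pot'' (x i / sig) * (h i / sig))"
    proof -
      have e: "lam * sig * b\<^sup>2 * (P - Q - R * (h i / sig)) = lam * (sig * b\<^sup>2 * P) - lam * (sig * b\<^sup>2 * Q) - lam * (b\<^sup>2 * R) * h i"
        for P Q R using sig by (simp add: algebra_simps)
      show ?thesis
        unfolding e ip_hess[OF i] egrad_0 vadd_def add_divide_distrib
        by (cases "i = 0"; cases "i < T") (simp_all add: algebra_simps)
    qed
    also have "\<bar>\<dots>\<bar> \<le> lam * sig * b\<^sup>2 * (220 * (h i / sig)\<^sup>2)"
      unfolding abs_mult[of "lam * sig * b\<^sup>2"] using lam sig
      by (intro mult_mono taylor_of_lipschitz_deriv[OF pot'_deriv lipschitz_pot'']) auto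
    also have "\<dots> = 220 * lam * b\<^sup>2 / sig * (h i)\<^sup>2"
      using sig by (simp add: power_divide power2_eq_square)
    also have "\<dots> \<le> 220 * lam * b\<^sup>2 / sig * (\<Sum>i<Suc T. (h i)\<^sup>2)"
      using lam sig i by (intro mult_left_mono member_le_sum) auto
    finally show "\<bar>(if i < Suc T then egrad 0 (vadd x h) i else 0) - (if i < Suc T then egrad 0 x i else 0)
      - ip (Suc T) (\<lambda>j. if j < Suc T then hess x i j else 0) h\<bar> \<le> 220 * lam * b\<^sup>2 / sig * (\<Sum>i<Suc T. (h i)\<^sup>2)"
      using i by (simp add: ip)
  qed (use lam sig in \<open>auto simp: vec_def\<close>)
next
  fix x x' v :: "nat \<Rightarrow> real"
  define L where "L = 220 * lam * b\<^sup>2 / sig"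
  have L: "0 \<le> L" using lam sig by (simp add: L_def)
  define dH where "dH i = ip (Suc T) (\<lambda>j. if j < Suc T then hess x i j else 0) v
    - ip (Suc T) (\<lambda>j. if j < Suc T then hess x' i j else 0) v" for i
  have "(dH i)\<^sup>2 \<le> (L * enorm (Suc T) (vsub x x'))\<^sup>2 * (v i)\<^sup>2" if i: "i < Suc T" for i
  proof -
    have "dH i = ip (Suc T) (hess x i) v - ip (Suc T) (hess x' i) v"
      by (simp add: ip_def dH_def)
    also have "\<dots> = lam * b\<^sup>2 * (pot'' (x i / sig) - pot'' (x' i / sig)) * v i"
      unfolding ip_hess[OF i] by (simp add: algebra_simps)
    finally have "\<bar>dH i\<bar> = lam * b\<^sup>2 * \<bar>pot'' (x i / sig) - pot'' (x' i / sig)\<bar> * \<bar>v i\<bar>"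
      using lam by (simp add: abs_mult)
    also have "\<dots> \<le> lam * b\<^sup>2 * (220 * \<bar>x i / sig - x' i / sig\<bar>) * \<bar>v i\<bar>"
      using lam by (intro mult_right_mono mult_left_mono lipschitz_pot'') auto
    also have "\<dots> = L * \<bar>vsub x x' i\<bar> * \<bar>v i\<bar>"
      using sig by (simp add: L_def vsub_def flip: diff_divide_distrib)
    also have "\<dots> \<le> L * enorm (Suc T) (vsub x x') * \<bar>v i\<bar>"
    proof (intro mult_right_mono mult_left_mono L)
      have "\<bar>vsub x x' i\<bar>\<^sup>2 \<le> (enorm (Suc T) (vsub x x'))\<^sup>2"
        unfolding enorm_power2 using i by (simp only: power2_abs) (intro member_le_sum, auto)
      then show "\<bar>vsub x x' i\<bar> \<le> enorm (Suc T) (vsub x x')"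
        using enorm_nonneg by (rule power2_le_imp_le)
    qed auto
    finally have "\<bar>dH i\<bar>\<^sup>2 \<le> (L * enorm (Suc T) (vsub x x') * \<bar>v i\<bar>)\<^sup>2" by (intro power_mono) auto
    then show ?thesis by (simp add: power_mult_distrib)
  qed
  then have "(enorm (Suc T) dH)\<^sup>2 \<le> (L * enorm (Suc T) (vsub x x') * enorm (Suc T) v)\<^sup>2"
    unfolding power_mult_distrib[of _ "enorm (Suc T) v"] enorm_power2[of _ dH] enorm_power2[of _ v] sum_distrib_left
    by (intro sum_mono) auto
  then have "enorm (Suc T) dH \<le> L * enorm (Suc T) (vsub x x') * enorm (Suc T) v"
    by (rule power2_le_imp_le) (use L enorm_nonneg in simp)
  then show "enorm (Suc T) (\<lambda>i. ip (Suc T) (\<lambda>j. if j < Suc T then hess x i j else 0) v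
      - ip (Suc T) (\<lambda>j. if j < Suc T then hess x' i j else 0) v)
    \<le> 220 * lam * b\<^sup>2 / sig * enorm (Suc T) (vsub x x') * enorm (Suc T) v"
    unfolding dH_def L_def .
qed

lemma energy_gap: "energy 0 (\<lambda>_. 0) - energy 0 x \<le> lam * sig\<^sup>2 * (b / 2 + 20 * b\<^sup>2 * real (Suc T))"
proof -
  have "energy 0 (\<lambda>_. 0) = lam * sig\<^sup>2 * (b / 2 + b\<^sup>2 * (real (Suc T) * pot 0))"
    unfolding energy_blocks base_def by simp
  also have "\<dots> \<le> lam * sig\<^sup>2 * (b / 2 + b\<^sup>2 * (real (Suc T) * 20))"
    using lam by (intro mult_left_mono add_left_mono pot_0_le) auto
  also have "0 \<le> energy 0 x"
    unfolding energy_blocks base_def using lam b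
    by (intro mult_nonneg_nonneg add_nonneg_nonneg sum_nonneg pot_nonneg) auto
  then have "lam * sig\<^sup>2 * (b / 2 + b\<^sup>2 * (real (Suc T) * 20)) \<le> lam * sig\<^sup>2 * (b / 2 + b\<^sup>2 * (real (Suc T) * 20)) + energy 0 x"
    by simp
  finally show ?thesis by (simp add: algebra_simps)
qed

text \<open>With z = 1 - x / sig, the gradient entries 0 to T - 1 become the residuals in the
  recursion of \<open>large_gradient\<close>; the two vanishing coordinates say that z rests at
  1.\<close>

lemma egrad_large:
  assumes "x (T - 1) = 0" "x T = 0"
  shows "(lam * sig)\<^sup>2 * b ^ 3 / 1024 < (\<Sum>i<Suc T. (egrad 0 x i)\<^sup>2)"
proof -
  define r where "r k = - egrad 0 x k / (lam * sig)" for k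
  define z where "z k = 1 - x k / sig" for k
  have "b ^ 3 / 1024 < (\<Sum>k<T. (r k)\<^sup>2)"
  proof (rule large_gradient[where \<psi> = "\<lambda>v. - pot' (1 - v)" and z = z])
    show "0 \<le> - pot' (1 - v)" for v using pot'_nonpos[of "1 - v"] by simp
    show "2 * v \<le> - pot' (1 - v)" if "v \<le> 1/2" for v using pot'_right[of "1 - v"] that by simp
    show "1/2 \<le> - pot' (1 - v)" if "5/4 \<le> v" for v using pot'_left[of "1 - v"] that by simp
    have "stiff 0 T 0 = 1" using T by (simp add: stiff_def)
    then show "z 1 - z 0 = b * z 0 + b\<^sup>2 * - pot' (1 - z 0) - r 0"
      using T lam sig by (simp add: r_def z_def egrad_0 field_simps)
    show "z (Suc (Suc k)) - z (Suc k) = z (Suc k) - z k + b\<^sup>2 * - pot' (1 - z (Suc k)) - r (Suc k)"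
      if "Suc k < T" for k
    proof -
      have "stiff 0 T (Suc k) = 2" using that by (simp add: stiff_def)
      then show ?thesis using that lam sig by (simp add: r_def z_def egrad_0 field_simps)
    qed
  qed (use b T assms in \<open>auto simp: z_def\<close>)
  also have "\<dots> = (\<Sum>k<T. (egrad 0 x k)\<^sup>2) / (lam * sig)\<^sup>2"
    by (simp add: r_def power_divide sum_divide_distrib)
  finally have "(lam * sig)\<^sup>2 * b ^ 3 / 1024 < (\<Sum>k<T. (egrad 0 x k)\<^sup>2)"
    using lam sig by (simp add: field_simps)
  also have "\<dots> \<le> (\<Sum>k<Suc T. (egrad 0 x k)\<^sup>2)" by simp
  finally show ?thesis .
qed

lemma egrad_zero_chain:
  assumes "\<And>r. s \<le> r \<Longrightarrow> z r = 0" "s < r"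
  shows "egrad m z r = 0"
  \<comment> \<open>The only inhomogeneous term, the spring towards 1, sits at position 0, which s <
    r excludes; elsewhere \<open>pot'\<close> vanishes at 0 and both neighbours of r lie at or
    beyond s.\<close>
  using assms by (simp add: egrad_def chain_grad_def nodal'_def)

text \<open>A query at an iterate supported below position s reveals at most position s itself.
  Interlacing matters here: x and y may be updated together, yet the joint support grows by at most
  one position per step.\<close>

lemma zero_chain:
  assumes "first_order_iterates (grad_x m) (grad_y m) xs ys" "t \<le> r"
  shows "join m (xs t) (ys t) r = 0"
  using assms(2)
proof (induction t arbitrary: r rule: less_induct)
  case (less t)
  show ?case
  proof (cases t)
    case 0
    then show ?thesis using assms(1) by (simp add: first_order_iterates_def join_def)
  next
    case (Suc t')
    have IH: "join m (xs s) (ys s) r = 0" "egrad m (join m (xs s) (ys s)) r = 0" if "s \<le> t'" for s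
    proof -
      have z: "join m (xs s) (ys s) q = 0" if "s \<le> q" for q
        using less.IH[of s q] that \<open>s \<le> t'\<close> Suc by simp
      show "join m (xs s) (ys s) r = 0" using z[of r] that less.prems Suc by simp
      show "egrad m (join m (xs s) (ys s)) r = 0"
        by (rule egrad_zero_chain[of s]) (use z that less.prems Suc in auto)
    qed
    show ?thesis
    proof (cases r rule: position_cases[where m = m])
      case (1 i)
      have "xs t i = 0"
      proof (rule ccontr)
        assume "xs t i \<noteq> 0"
        then obtain s where "s \<le> t'" "xs s i \<noteq> 0 \<or> grad_x m (xs s) (ys s) i \<noteq> 0"
          using assms(1) unfolding first_order_iterates_def supp_def Suc by blast
        then show False using IH[of s] by (auto simp: 1 grad_x_def split: if_splits)
      qed
      then show ?thesis by (simp add: 1)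
    next
      case (2 j)
      have "ys t j = 0"
      proof (rule ccontr)
        assume "ys t j \<noteq> 0"
        then obtain s where "s \<le> t'" "ys s j \<noteq> 0 \<or> grad_y m (xs s) (ys s) j \<noteq> 0"
          using assms(1) unfolding first_order_iterates_def supp_def Suc by blast
        then show False using IH[of s] 2 by (auto simp: grad_y_def split: if_splits)
      qed
      then show ?thesis by (simp add: 2)
    qed
  qed
qed

text \<open>The bound on t is the position of primal coordinate T - 1, so coordinates T - 1 and T
  are still zero.\<close>

lemma gradient_norm_large:
  assumes "first_order_iterates (grad_x m) (grad_y m) xs ys" "t \<le> (T - 1) * Suc m"
    "has_grad (Suc T) (Phi (T * m) (obj m)) G (xs t)"
  shows "(lam * sig)\<^sup>2 * b ^ 3 / 1024 < (enorm (Suc T) G)\<^sup>2"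
proof -
  have "xs t i = 0" if "T - 1 \<le> i" for i
  proof -
    have "t \<le> posx m i" unfolding posx_def using assms(2) mult_le_mono1[OF that, of "Suc m"] by linarith
    then show ?thesis using zero_chain[OF assms(1), of t "posx m i"] by simp
  qed
  then have "(lam * sig)\<^sup>2 * b ^ 3 / 1024 < (\<Sum>i<Suc T. (egrad 0 (xs t) i)\<^sup>2)"
    by (intro egrad_large) auto
  moreover have "G = (\<lambda>i. if i < Suc T then egrad 0 (xs t) i else 0)"
    using has_grad_unique[OF assms(3)[unfolded Phi_obj] has_grad_energy] .
  ultimately show ?thesis by (simp add: enorm_power2)
qed

end

section \<open>Choice of scales\<close>

lemma powr_root_power:
  fixes X :: real assumes "0 < X" "0 < n"
  shows "(X powr (a / real n)) ^ n = X powr a"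
  using assms by (simp add: powr_realpow[symmetric] powr_powr)

text \<open>The scales are forced by \<open>b\<^sup>7 = (32 \<epsilon> L\<^sub>2 / (220 \<lambda>\<^sup>2))\<^sup>2\<close>; fractional powers are compared through their 7th and
  10th powers.\<close>

lemma exists_scales:
  fixes \<Delta> l L2 \<epsilon> :: real
  assumes pos: "0 < \<Delta>" "0 < l" "0 < L2" "0 < \<epsilon>"
    and c1: "\<epsilon> \<le> 1/4 * (l / 10 ^ 12) powr 2 * (L2 / 10 ^ 12) powr (- 1)"
    and c2: "\<epsilon> \<le> 1/4 * \<Delta> powr (7/10) * (l / 10 ^ 12) powr (- 1/10) * (L2 / 10 ^ 12) powr (2/5)"
  obtains lam sig b where "0 < lam" "0 < sig" "0 < b" "b \<le> 1/2" "42 * lam = l"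
    "220 * lam * b\<^sup>2 / sig = L2" "(lam * sig)\<^sup>2 * b ^ 3 / 1024 = \<epsilon>\<^sup>2"
    "lam * sig\<^sup>2 * b \<le> \<Delta> / 320"
    "2 / 10 ^ 7 * (l powr (3/7) * L2 powr (2/7) * \<epsilon> powr (- 12/7)) \<le> 1 / (40 * lam * sig\<^sup>2 * b\<^sup>2)"
proof -
  define lam where "lam = l / 42"
  define X where "X = 32 * \<epsilon> * L2 / (220 * lam\<^sup>2)"
  define b where "b = X powr (2 / real 7)"
  \<comment> \<open>Solves the Hessian condition for \<open>sig\<close>; inserting it in the
    gradient condition leaves \<open>b ^ 7 = X^2\<close>.\<close>
  define sig where "sig = 220 * lam * b\<^sup>2 / L2"
  have lam: "0 < lam" and l: "l = 42 * lam" using pos by (auto simp: lam_def)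
  have X: "0 < X" using pos lam by (simp add: X_def)
  have b: "0 < b" using X by (simp add: b_def)
  have sig: "0 < sig" using pos lam b by (simp add: sig_def)
  have b7: "b ^ 7 = X\<^sup>2" unfolding b_def using powr_root_power[OF X, of 7 2] X by (simp add: powr_numeral)
  have "\<epsilon> \<le> 1/4 * (l\<^sup>2 / (10 ^ 12)\<^sup>2) * (10 ^ 12 / L2)"
    using c1 pos by (simp add: powr_minus_divide power_divide)
  then have "\<epsilon> * L2 * (4 * 10 ^ 12) \<le> l\<^sup>2" using pos by (simp add: field_simps)
  then have "X \<le> 32 / 220 * (42 * 42) / (4 * 10 ^ 12)"
    using lam unfolding X_def l by (simp add: divide_simps power2_eq_square)
  then have "X \<le> 1 / 16" by simp
  then have "X\<^sup>2 \<le> (1/16)\<^sup>2" using X by (intro power_mono) auto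
  also have "(1/16)\<^sup>2 \<le> (1/2 :: real) ^ 7" by (simp add: power_divide)
  finally have "b ^ 7 \<le> (1/2) ^ 7" unfolding b7 .
  then have b2: "b \<le> 1/2" by (rule power_le_imp_le_base[where n = 6, simplified]) simp
  have grad: "(lam * sig)\<^sup>2 * b ^ 3 / 1024 = \<epsilon>\<^sup>2"
  proof -
    have "(lam * sig)\<^sup>2 * b ^ 3 / 1024 = (220 * lam\<^sup>2 / L2)\<^sup>2 * b ^ 7 / 1024"
      unfolding sig_def by (simp add: power_mult_distrib power_divide flip: power_mult power_add)
    also have "\<dots> = \<epsilon>\<^sup>2" unfolding b7 X_def using pos lam by (simp add: power_mult_distrib power_divide)
    finally show ?thesis .
  qed
  \<comment> \<open>These exponents are what 7th powers of the gap and the rate contain; being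
    multiples of 7, they turn b into X, free of roots.\<close>
  have b35: "b ^ 35 = X ^ 10" and b42: "b ^ 42 = X ^ 12"
    using power_mult[of b 7 5] power_mult[of b 7 6] b7 by (simp_all flip: power_mult)
  have gap: "lam * sig\<^sup>2 * b \<le> \<Delta> / 320"
  proof -
    have "\<epsilon> ^ 10 \<le> (1/4 * \<Delta> powr (7/10) * (l / 10 ^ 12) powr (- 1/10) * (L2 / 10 ^ 12) powr (2/5)) ^ 10"
      using c2 pos by (intro power_mono) auto
    also have "\<dots> = (1/4) ^ 10 * (\<Delta> powr (7/10)) ^ 10 * ((l / 10 ^ 12) powr (- 1/10)) ^ 10 * ((L2 / 10 ^ 12) powr (2/5)) ^ 10"
      unfolding power_mult_distrib ..
    also have "(\<Delta> powr (7/10)) ^ 10 = \<Delta> ^ 7"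
      using powr_root_power[of \<Delta> 10 7] pos by (simp add: powr_numeral)
    also have "((l / 10 ^ 12) powr (- 1/10)) ^ 10 = 10 ^ 12 / l"
      using powr_root_power[of "l / 10 ^ 12" 10 "-1"] pos by (simp add: powr_minus_divide)
    also have "((L2 / 10 ^ 12) powr (2/5)) ^ 10 = (L2 / 10 ^ 12) ^ 4"
      using powr_root_power[of "L2 / 10 ^ 12" 10 4] pos by (simp add: powr_numeral)
    finally have e10: "\<epsilon> ^ 10 \<le> (1/4) ^ 10 * \<Delta> ^ 7 * (10 ^ 12 / l) * (L2 / 10 ^ 12) ^ 4" .
    have "(lam * sig\<^sup>2 * b) ^ 7 = 220 ^ 14 * lam ^ 21 / L2 ^ 14 * b ^ 35"
      unfolding sig_def by (simp add: power_mult_distrib power_divide flip: power_mult power_add)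
    also have "\<dots> = 220 ^ 4 * 32 ^ 10 * lam / L2 ^ 4 * \<epsilon> ^ 10"
      unfolding b35 X_def power_mult_distrib power_divide using pos lam
      by (simp add: divide_simps flip: power_mult) (simp add: eval_nat_numeral)
    also have "\<dots> \<le> 220 ^ 4 * 32 ^ 10 * lam / L2 ^ 4 * ((1/4) ^ 10 * \<Delta> ^ 7 * (10 ^ 12 / l) * (L2 / 10 ^ 12) ^ 4)"
      using pos lam by (intro mult_left_mono e10) auto
    \<comment> \<open>The constant 10^12 enters with net power -3, which brings the numerical factor
      below 320^(-7).\<close>
    also have "\<dots> = 220 ^ 4 * 32 ^ 10 * (1/4) ^ 10 / 42 / 10 ^ 36 * \<Delta> ^ 7"
      unfolding l power_divide using pos lam by (simp add: divide_simps)
    also have "\<dots> \<le> (1 / 320) ^ 7 * \<Delta> ^ 7"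
      using pos by (intro mult_right_mono) (simp_all add: power_divide)
    also have "\<dots> = (\<Delta> / 320) ^ 7" by (simp add: power_divide)
    finally show ?thesis by (rule power_le_imp_le_base[where n = 6, simplified]) (use pos in simp)
  qed
  have rate: "2 / 10 ^ 7 * (l powr (3/7) * L2 powr (2/7) * \<epsilon> powr (- 12/7)) \<le> 1 / (40 * lam * sig\<^sup>2 * b\<^sup>2)"
  proof -
    have "(2 / 10 ^ 7 * (l powr (3/7) * L2 powr (2/7) * \<epsilon> powr (- 12/7))) ^ 7
      = (2 / 10 ^ 7) ^ 7 * ((l powr (3/7)) ^ 7 * (L2 powr (2/7)) ^ 7 * (\<epsilon> powr (- 12/7)) ^ 7)"
      unfolding power_mult_distrib ..
    also have "(l powr (3/7)) ^ 7 = l ^ 3"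
      using powr_root_power[of l 7 3] pos by (simp add: powr_numeral)
    also have "(L2 powr (2/7)) ^ 7 = L2 ^ 2"
      using powr_root_power[of L2 7 2] pos by (simp add: powr_numeral)
    also have "(\<epsilon> powr (- 12/7)) ^ 7 = 1 / \<epsilon> ^ 12"
      using powr_root_power[of \<epsilon> 7 "-12"] pos by (simp add: powr_minus_divide powr_numeral)
    finally have w: "(2 / 10 ^ 7 * (l powr (3/7) * L2 powr (2/7) * \<epsilon> powr (- 12/7))) ^ 7
      = (2 / 10 ^ 7) ^ 7 * (l ^ 3 * L2\<^sup>2 * (1 / \<epsilon> ^ 12))" .
    have "(1 / (40 * lam * sig\<^sup>2 * b\<^sup>2)) ^ 7 = L2 ^ 14 / (40 ^ 7 * 220 ^ 14 * lam ^ 21 * b ^ 42)"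
      unfolding sig_def by (simp add: power_mult_distrib power_divide flip: power_mult power_add)
    also have "\<dots> = 1 / (40 ^ 7 * 220\<^sup>2 * 32 ^ 12) * (lam ^ 3 * L2\<^sup>2 * (1 / \<epsilon> ^ 12))"
      unfolding b42 X_def power_mult_distrib power_divide using pos lam
      by (simp add: divide_simps flip: power_mult) (simp add: eval_nat_numeral)
    finally have r: "(1 / (40 * lam * sig\<^sup>2 * b\<^sup>2)) ^ 7 = \<dots>" .
    have "(2 / 10 ^ 7) ^ 7 * 42 ^ 3 * (lam ^ 3 * L2\<^sup>2 * (1 / \<epsilon> ^ 12)) \<le> 1 / (40 ^ 7 * 220\<^sup>2 * 32 ^ 12) * (lam ^ 3 * L2\<^sup>2 * (1 / \<epsilon> ^ 12))"
      using pos lam by (intro mult_right_mono) (simp_all add: power_divide)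
    then have "(2 / 10 ^ 7 * (l powr (3/7) * L2 powr (2/7) * \<epsilon> powr (- 12/7))) ^ 7 \<le> (1 / (40 * lam * sig\<^sup>2 * b\<^sup>2)) ^ 7"
      unfolding w r unfolding l power_mult_distrib by (simp only: mult.assoc)
    then show ?thesis by (rule power_le_imp_le_base[where n = 6, simplified]) (use lam in simp)
  qed
  show ?thesis
    by (rule that[OF lam sig b b2 _ _ grad gap rate]) (use l lam b pos in \<open>auto simp: sig_def\<close>)
qed

theorem theorem2:
  shows "\<exists>l1>0. \<exists>l2>0. \<exists>c>0. \<forall>(\<Delta>::real) (l::real) (L2::real) (\<mu>::real) (\<epsilon>::real).
    \<Delta> > 0 \<and> l > 0 \<and> L2 > 0 \<and> \<mu> > 0 \<and> \<epsilon> > 0 \<and> l / \<mu> \<ge> 1 \<and>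
    \<epsilon> \<le> min (1/4 * (l / l1) powr 2 * (L2 / l2) powr (-1))
              (1/4 * \<Delta> powr (7/10) * (l / l1) powr (-1/10) * (L2 / l2) powr (2/5))
    \<longrightarrow> (\<exists>dx dy f gx gy.
          smooth_with_grad dx dy f gx gy l \<and>
          strongly_concave_y dx dy f \<mu> \<and>
          hessian_lipschitz dx (Phi dy f) L2 \<and>
          (\<forall>x\<in>vec dx. Phi dy f (\<lambda>_. 0) - Phi dy f x \<le> \<Delta>) \<and>
          (\<forall>xs ys. first_order_iterates gx gy xs ys \<longrightarrow>
             (\<forall>t::nat. real t < c * \<Delta> * sqrt (l / \<mu>) * l powr (3/7) * L2 powr (2/7) * \<epsilon> powr (-12/7)
                \<longrightarrow> (\<forall>G. has_grad dx (Phi dy f) G (xs t) \<longrightarrow> enorm dx G > \<epsilon>))))"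
proof (rule exI[of _ "10 ^ 12"], rule conjI, simp, rule exI[of _ "10 ^ 12"], rule conjI, simp,
    rule exI[of _ "1 / 10 ^ 8"], rule conjI, simp, intro allI impI)
  fix \<Delta> l L2 \<mu> \<epsilon> :: real
  assume "\<Delta> > 0 \<and> l > 0 \<and> L2 > 0 \<and> \<mu> > 0 \<and> \<epsilon> > 0 \<and> l / \<mu> \<ge> 1 \<and>
    \<epsilon> \<le> min (1/4 * (l / 10 ^ 12) powr 2 * (L2 / 10 ^ 12) powr (-1))
              (1/4 * \<Delta> powr (7/10) * (l / 10 ^ 12) powr (-1/10) * (L2 / 10 ^ 12) powr (2/5))"
  then have pos: "0 < \<Delta>" "0 < l" "0 < L2" "0 < \<mu>" "0 < \<epsilon>"
    and c12: "\<epsilon> \<le> 1/4 * (l / 10 ^ 12) powr 2 * (L2 / 10 ^ 12) powr (- 1)"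
      "\<epsilon> \<le> 1/4 * \<Delta> powr (7/10) * (l / 10 ^ 12) powr (- 1/10) * (L2 / 10 ^ 12) powr (2/5)"
    by (simp_all only: min.bounded_iff divide_minus_left)
  define W where "W = l powr (3/7) * L2 powr (2/7) * \<epsilon> powr (- 12/7)"
  obtain lam sig b where p: "0 < lam" "0 < sig" "0 < b" "b \<le> 1/2" and l: "42 * lam = l"
    and L2: "220 * lam * b\<^sup>2 / sig = L2" and eps: "(lam * sig)\<^sup>2 * b ^ 3 / 1024 = \<epsilon>\<^sup>2"
    and gap: "lam * sig\<^sup>2 * b \<le> \<Delta> / 320"
    and rate: "2 / 10 ^ 7 * W \<le> 1 / (40 * lam * sig\<^sup>2 * b\<^sup>2)"
    using exists_scales[OF pos(1-3,5) c12] unfolding W_def by blast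
  \<comment> \<open>With at most M primal nodes, each costing 20 lam sig^2 b^2, the potential uses
    at most half of \<Delta>. The bound \<Delta> / 320 in \<open>gap\<close> gives M >= 16, so
    rounding and the two end nodes lose at most half of M.\<close>
  define M where "M = \<Delta> / (40 * lam * sig\<^sup>2 * b\<^sup>2)"
  define T where "T = nat \<lfloor>M\<rfloor> - 1"
  \<comment> \<open>Here 84 = 2 * 42: m (m + 1) <= 2 m^2 <= l / (42 \<mu>) = lam / \<mu>, as the
    concavity modulus demands. If this rounds to m = 0, a single query per edge already matches the
    required order.\<close>
  define m where "m = nat \<lfloor>sqrt (l / \<mu> / 84)\<rfloor>"
  have "lam * sig\<^sup>2 * b * b \<le> \<Delta> / 320 * (1/2)" using gap p pos by (intro mult_mono) auto
  then have q: "lam * sig\<^sup>2 * b\<^sup>2 \<le> \<Delta> / 640" by (simp add: power2_eq_square mult.assoc)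
  have q0: "0 < lam * sig\<^sup>2 * b\<^sup>2" using p by simp
  have "16 * (40 * (lam * sig\<^sup>2 * b\<^sup>2)) \<le> \<Delta>" using q by simp
  then have M: "16 \<le> M" unfolding M_def using q0 by (simp add: le_divide_eq mult.assoc)
  have T_eq: "real (Suc T) = \<lfloor>M\<rfloor>" unfolding T_def using M by (simp add: le_nat_iff of_nat_diff)
  have T_le: "real (Suc T) \<le> M" unfolding T_eq by simp
  have T_ge: "M / 2 \<le> real (T - 1)"
  proof -
    have "M - 1 \<le> real (Suc T)" unfolding T_eq by linarith
    then show ?thesis using M by linarith
  qed
  interpret hard_instance lam sig b T
    by unfold_locales (use p T_ge M in auto)
  have conc: "m = 0 \<or> \<mu> \<le> lam * mass m"
  proof (cases "m = 0")
    case False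
    have "real m \<le> sqrt (l / \<mu> / 84)" unfolding m_def using pos by simp
    then have "(real m)\<^sup>2 \<le> (sqrt (l / \<mu> / 84))\<^sup>2" by (intro power_mono) auto
    then have "(real m)\<^sup>2 \<le> l / \<mu> / 84" using pos by simp
    then have "\<mu> * (2 * (real m)\<^sup>2) \<le> lam" using pos l by (simp add: field_simps)
    moreover have "real m * real (Suc m) \<le> 2 * (real m)\<^sup>2" using False by (simp add: power2_eq_square algebra_simps)
    ultimately have "\<mu> * (real m * real (Suc m)) \<le> lam"
      using pos by (meson mult_left_mono order.trans less_imp_le)
    moreover have "0 < real m * real (Suc m)" using False by simp
    ultimately show ?thesis by (simp add: mass_def pos_le_divide_eq del: of_nat_Suc)
  qed simp
  have m_ge: "sqrt (l / \<mu>) / 10 \<le> real (Suc m)"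
  proof -
    have "sqrt (l / \<mu>) / 10 = sqrt (l / \<mu> / 10\<^sup>2)"
      by (simp only: real_sqrt_divide[of _ "10\<^sup>2"] real_sqrt_abs abs_numeral)
    also have "\<dots> \<le> sqrt (l / \<mu> / 84)" using pos by (intro real_sqrt_le_mono) (simp add: field_simps)
    also have "\<dots> \<le> real (Suc m)" unfolding m_def using pos by linarith
    finally show ?thesis .
  qed
  show "\<exists>dx dy f gx gy.
          smooth_with_grad dx dy f gx gy l \<and>
          strongly_concave_y dx dy f \<mu> \<and>
          hessian_lipschitz dx (Phi dy f) L2 \<and>
          (\<forall>x\<in>vec dx. Phi dy f (\<lambda>_. 0) - Phi dy f x \<le> \<Delta>) \<and>
          (\<forall>xs ys. first_order_iterates gx gy xs ys \<longrightarrow>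
             (\<forall>t::nat. real t < 1 / 10 ^ 8 * \<Delta> * sqrt (l / \<mu>) * l powr (3/7) * L2 powr (2/7) * \<epsilon> powr (-12/7)
                \<longrightarrow> (\<forall>G. has_grad dx (Phi dy f) G (xs t) \<longrightarrow> enorm dx G > \<epsilon>)))"
  proof (intro exI conjI ballI allI impI)
    show "smooth_with_grad (Suc T) (T * m) (obj m) (grad_x m) (grad_y m) l"
      using smooth_obj unfolding l .
    show "strongly_concave_y (Suc T) (T * m) (obj m) \<mu>"
      by (rule strongly_concave_obj[OF conc])
    show "hessian_lipschitz (Suc T) (Phi (T * m) (obj m)) L2"
      using hessian_lipschitz_energy unfolding Phi_obj L2 .
    fix x
    have "energy 0 (\<lambda>_. 0) - energy 0 x \<le> lam * sig\<^sup>2 * (b / 2 + 20 * b\<^sup>2 * real (Suc T))"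
      by (rule energy_gap)
    also have "\<dots> \<le> lam * sig\<^sup>2 * (b / 2 + 20 * b\<^sup>2 * M)"
      using p T_le by (intro mult_left_mono add_left_mono) auto
    also have "\<dots> = lam * sig\<^sup>2 * b / 2 + \<Delta> / 2"
      using p by (simp add: M_def field_simps)
    also have "\<dots> \<le> \<Delta>" using gap pos by simp
    finally show "Phi (T * m) (obj m) (\<lambda>_. 0) - Phi (T * m) (obj m) x \<le> \<Delta>" unfolding Phi_obj .
  next
    fix xs ys t G
    assume it: "first_order_iterates (grad_x m) (grad_y m) xs ys"
      and t: "real t < 1 / 10 ^ 8 * \<Delta> * sqrt (l / \<mu>) * l powr (3/7) * L2 powr (2/7) * \<epsilon> powr (-12/7)"
      and G: "has_grad (Suc T) (Phi (T * m) (obj m)) G (xs t)"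
    have "2 / 10 ^ 7 * W * \<Delta> \<le> M"
      using mult_right_mono[OF rate, of \<Delta>] pos by (simp add: M_def)
    then have MW: "2 / 10 ^ 7 * (\<Delta> * W) / 2 \<le> real (T - 1)" using T_ge by (simp add: mult.commute)
    \<comment> \<open>The constant 10^(-8) is 2 / 10^7 from the rate, halved by \<open>T_ge\<close>
      and divided by 10 in \<open>m_ge\<close>.\<close>
    have "real t < (2 / 10 ^ 7 * (\<Delta> * W) / 2) * (sqrt (l / \<mu>) / 10)"
      using t by (simp add: W_def mult_ac)
    also have "\<dots> \<le> real (T - 1) * real (Suc m)"
      using MW m_ge pos by (intro mult_mono) auto
    finally have "t \<le> (T - 1) * Suc m" by (simp only: of_nat_mult[symmetric] of_nat_less_iff less_imp_le)
    from gradient_norm_large[OF it this G] have "\<epsilon>\<^sup>2 < (enorm (Suc T) G)\<^sup>2" unfolding eps .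
    then show "\<epsilon> < enorm (Suc T) G" by (rule power2_less_imp_less) (rule enorm_nonneg)
  qed
qed

end
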